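(* Let $\{(R_n,B_n)\}_{n=1}^\infty\subseteq\mathcal{D}_d$ be a sequence of admissible pairs in $\mathbb{R}^d$. Suppose there is an admissible pair $(R,B)$ occurring infinitely many times in the sequence such that all diagonal entries of $R$ are $\ge d+1$. Then the infinite convolution $$\mu=\delta_{R_1^{-1}B_1}*\delta_{(R_2R_1)^{-1}B_2}*\cdots*\delta_{(R_n\cdots R_1)^{-1}B_n}*\cdots$$ is a spectral measure with a spectrum contained in $\mathbb{Z}^d$.
   Context: $\mathcal{D}_d$ is the set of pairs $(R,B)$ with $R=\mathrm{diag}(m_1,\dots,m_d)$, $m_1,\dots,m_d\ge2$ integers, and $B$ a nonempty subset of $\{0,\dots,m_1-1\}\times\cdots\times\{0,\dots,m_d-1\}$. For a finite $A\subseteq\mathbb{R}^d$, $\delta_A=\frac{1}{\#A}\sum_{a\in A}\delta_a$; for a sequence in $\mathcal{D}_d$ the finite convolutions $\delta_{R_1^{-1}B_1}*\cdots*\delta_{(R_n\cdots R_1)^{-1}B_n}$ converge weakly, and $\mu$ denotes the limit. A pair $(R,B)$ ($R$ expanding integer matrix, $B\subseteq\mathbb{Z}^d$ finite) is admissible if there is a finite $L\subseteq\mathbb{Z}^d$ with $\#L=\#B$ such that $\big[\frac{1}{\sqrt{\#B}}e^{-2\pi i(R^{-1}b)\cdot\ell}\big]_{b\in B,\ell\in L}$ is unitary. A Borel probability measure $\mu$ is spectral if there is a countable $\Lambda\subseteq\mathbb{R}^d$ (a spectrum) with $\{e^{2\pi i\lambda\cdot x}\}_{\lambda\in\Lambda}$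 an orthonormal basis of $L^2(\mu)$. *)

theory Defs
  imports "HOL-Analysis.Analysis" "HOL-Probability.Probability"
begin

text \<open>Dimension d = CARD('d). A diagonal matrix R = diag(m_1,...,m_d) is represented
  by its diagonal m :: 'd => nat; digit sets B are sets of integer vectors.\<close>

definition in_D :: "('d::finite \<Rightarrow> nat) \<Rightarrow> (int^'d) set \<Rightarrow> bool" where
  "in_D m B \<longleftrightarrow> (\<forall>i. m i \<ge> 2) \<and> B \<noteq> {} \<and>
     (\<forall>b\<in>B. \<forall>i. 0 \<le> b$i \<and> b$i < int (m i))"

definition diag_inv_apply :: "('d::finite \<Rightarrow> nat) \<Rightarrow> int^'d \<Rightarrow> real^'d" where
  "diag_inv_apply m b = (\<chi> i. real_of_int (b$i) / real (m i))"

definition int_vec :: "int^'d::finite \<Rightarrow> real^'d" where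
  "int_vec l = (\<chi> i. real_of_int (l$i))"

definition adm_entry :: "('d::finite \<Rightarrow> nat) \<Rightarrow> (int^'d) set \<Rightarrow> int^'d \<Rightarrow> int^'d \<Rightarrow> complex" where
  "adm_entry m B b l = complex_of_real (1 / sqrt (real (card B))) *
      cis (- 2 * pi * (diag_inv_apply m b \<bullet> int_vec l))"

definition admissible :: "('d::finite \<Rightarrow> nat) \<Rightarrow> (int^'d) set \<Rightarrow> bool" where
  "admissible m B \<longleftrightarrow> (\<exists>L. finite L \<and> card L = card B \<and>
     (\<forall>l\<in>L. \<forall>l'\<in>L. (\<Sum>b\<in>B. cnj (adm_entry m B b l) * adm_entry m B b l') =
                      (if l = l' then 1 else 0)) \<and>
     (\<forall>b\<in>B. \<forall>b'\<in>B. (\<Sum>l\<in>L. adm_entry m B b l * cnj (adm_entry m B b' l)) =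
                      (if b = b' then 1 else 0)))"

definition delta_set :: "(real^'d::finite) set \<Rightarrow> (real^'d) measure" where
  "delta_set A = distr (measure_pmf (pmf_of_set A)) borel (\<lambda>x. x)"

text \<open>(R_n ... R_1)^{-1} B_n for the sequence (indexed from 1).\<close>
definition scaled_digits :: "(nat \<Rightarrow> 'd::finite \<Rightarrow> nat) \<Rightarrow> (nat \<Rightarrow> (int^'d) set) \<Rightarrow> nat \<Rightarrow> (real^'d) set" where
  "scaled_digits ms Bs n =
     (\<lambda>b. (\<chi> i. real_of_int (b$i) / (\<Prod>k\<in>{1..n}. real (ms k i)))) ` Bs n"

primrec conv_partial :: "(nat \<Rightarrow> 'd::finite \<Rightarrow> nat) \<Rightarrow> (nat \<Rightarrow> (int^'d) set) \<Rightarrow> nat \<Rightarrow> (real^'d) measure" where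
  "conv_partial ms Bs 0 = return borel 0"
| "conv_partial ms Bs (Suc n) = convolution (conv_partial ms Bs n) (delta_set (scaled_digits ms Bs (Suc n)))"

definition weak_conv_vec :: "(nat \<Rightarrow> (real^'d::finite) measure) \<Rightarrow> (real^'d) measure \<Rightarrow> bool" where
  "weak_conv_vec Ms M \<longleftrightarrow> (\<forall>f :: real^'d \<Rightarrow> real. continuous_on UNIV f \<and> bounded (range f) \<longrightarrow>
      (\<lambda>n. integral\<^sup>L (Ms n) f) \<longlonglongrightarrow> integral\<^sup>L M f)"

definition expo :: "real^'d::finite \<Rightarrow> real^'d \<Rightarrow> complex" where
  "expo lam x = cis (2 * pi * (lam \<bullet> x))"

definition is_spectrum :: "(real^'d::finite) measure \<Rightarrow> (real^'d) set \<Rightarrow> bool" where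
  "is_spectrum M Lam \<longleftrightarrow> countable Lam \<and>
     (\<forall>l\<in>Lam. \<forall>l'\<in>Lam. (\<integral>x. expo l x * cnj (expo l' x) \<partial>M) = (if l = l' then 1 else 0)) \<and>
     (\<forall>f :: real^'d \<Rightarrow> complex. f \<in> borel_measurable M \<and> integrable M (\<lambda>x. (cmod (f x))\<^sup>2) \<longrightarrow>
        (\<forall>e>0. \<exists>F c. finite F \<and> F \<subseteq> Lam \<and>
            (\<integral>x. (cmod (f x - (\<Sum>l\<in>F. c l * expo l x)))\<^sup>2 \<partial>M) < e))"

definition spectral :: "(real^'d::finite) measure \<Rightarrow> bool" where
  "spectral M \<longleftrightarrow> prob_space M \<and> sets M = sets borel \<and> (\<exists>Lam. is_spectrum M Lam)"

end

theory Submission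
  imports Defs
begin

text \<open>
  Let \<open>\<nu>\<close> be a rescaled tail of the convolution, a measure on the unit cube. The exponentials of a
  suitable set of integer vectors are always orthogonal, and they are complete as soon as one can
  choose, at infinitely many stages and for every frequency \<open>x\<close>, an integer vector \<open>k\<close> with
  \<open>|\<nu>^(x + k)| \<ge> \<epsilon>\<close>, where \<open>\<epsilon>\<close> is uniform in \<open>x\<close> and in \<open>\<nu>\<close>: the Fourier transform of the finite
  convolution is then dominated by that of the limit, and Parseval's identity passes to the limit.

  The uniform bound holds for tails that start with the distinguished pair \<open>(R, B)\<close>. If all
  \<open>\<nu>^(x + k)\<close> were tiny, then the measure \<open>e(x \<cdot> v) d\<nu>(v)\<close>, pushed to the torus, would nearly vanish.
  On the cube, masses can only cancel between points that differ by a nonzero vector of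
  \<open>{-1, 0, 1}^d\<close>, so the translate belonging to a digit \<open>b\<close> must be cancelled by that of a digit \<open>b'\<close>
  lying across a pair of opposite faces. Following \<open>b \<rightarrow> b' \<rightarrow> \<dots>\<close> for \<open>d + 1\<close> steps, some coordinate
  crosses twice, which takes at least \<open>m_i \<ge> d + 1\<close> steps: a contradiction. Weak compactness is
  avoided by testing against finitely many continuous bump functions.
\<close>

section \<open>Approximation by trigonometric polynomials\<close>

text \<open>Orthogonality costs nothing: spectra of finite blocks multiply up. Completeness can fail
  because the frequencies of growing blocks escape to regions where the transform of the remaining
  tail is small. The remedy is a freedom in the blocks: a frequency of the first \<open>n\<close>
  layers may be moved by any integer vector in the image of \<open>R_n ... R_1\<close> without
  changing the block transform there, while the rescaled tail sees this as a translation by an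
  arbitrary integer vector \<open>k\<close>.

  No lower bound can hold for all measures on the cube: half the mass at 0 and half at 1 on the unit
  interval has transform 0 at every 1/2 + k. Points on opposite faces coincide on the torus, and the
  phases can make them cancel. Since nothing is known about what follows a given layer, the bound
  has to come from one digit layer, uniformly in the law after it. This is why the pair with large
  diagonal entries must recur: the bound is needed at infinitely many stages, each time with that
  pair as the first layer of the tail.\<close>

lemma complex_Stone_Weierstrass:
  fixes g :: "'i \<Rightarrow> 'a::t2_space \<Rightarrow> complex" and I :: "'i set" and S :: "'a set"
  assumes "compact S"
    and cont: "\<And>i. i \<in> I \<Longrightarrow> continuous_on S (g i)"
    and one: "\<exists>i\<in>I. \<forall>x\<in>S. g i x = 1"
    and mult: "\<And>i j. i \<in> I \<Longrightarrow> j \<in> I \<Longrightarrow> \<exists>k\<in>I. \<forall>x\<in>S. g k x = g i x * g j x"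
    and cnj: "\<And>i. i \<in> I \<Longrightarrow> \<exists>k\<in>I. \<forall>x\<in>S. g k x = cnj (g i x)"
    and sep: "\<And>x y. x \<in> S \<Longrightarrow> y \<in> S \<Longrightarrow> x \<noteq> y \<Longrightarrow> \<exists>i\<in>I. g i x \<noteq> g i y"
    and f: "continuous_on S f" and "0 < (e::real)"
  shows "\<exists>F c. finite F \<and> F \<subseteq> I \<and> (\<forall>x\<in>S. cmod (f x - (\<Sum>i\<in>F. c i * g i x)) < e)"
proof -
  \<comment> \<open>Membership in the span is only up to equality on \<open>S\<close>, because the
    closure hypotheses hold only there. The abstract index set lets one argument serve real
    frequencies on the cube and integer frequencies on the torus.\<close>
  define lin where "lin h \<longleftrightarrow> (\<exists>F c. finite F \<and> F \<subseteq> I \<and> (\<forall>x\<in>S. h x = (\<Sum>i\<in>F. c i * g i x)))"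
    for h :: "'a \<Rightarrow> complex"
  have lin_cong: "lin h" if A: "lin h'" "\<And>x. x \<in> S \<Longrightarrow> h x = h' x" for h h'
  proof -
    obtain F c where "finite F" "F \<subseteq> I" "\<forall>x\<in>S. h' x = (\<Sum>i\<in>F. c i * g i x)"
      using A(1) unfolding lin_def by blast
    then have "finite F \<and> F \<subseteq> I \<and> (\<forall>x\<in>S. h x = (\<Sum>i\<in>F. c i * g i x))"
      using A(2) by simp
    then show ?thesis
      unfolding lin_def by (intro exI)
  qed
  have lin_scale: "lin (\<lambda>x. a * h x)" if A: "lin h" for a h
  proof -
    obtain F c where "finite F" "F \<subseteq> I" "\<forall>x\<in>S. h x = (\<Sum>i\<in>F. c i * g i x)"
      using A unfolding lin_def by blast
    then show ?thesis
      unfolding lin_def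
      by (intro exI[of _ F] exI[of _ "\<lambda>i. a * c i"]) (simp add: sum_distrib_left mult.assoc)
  qed
  have lin_add: "lin (\<lambda>x. h x + h' x)" if A: "lin h" "lin h'" for h h'
  proof -
    obtain F c where F: "finite F" "F \<subseteq> I" "\<forall>x\<in>S. h x = (\<Sum>i\<in>F. c i * g i x)"
      using A(1) unfolding lin_def by blast
    obtain F' c' where F': "finite F'" "F' \<subseteq> I" "\<forall>x\<in>S. h' x = (\<Sum>i\<in>F'. c' i * g i x)"
      using A(2) unfolding lin_def by blast
    define d where "d i = (if i \<in> F then c i else 0) + (if i \<in> F' then c' i else 0)" for i
    have "h x + h' x = (\<Sum>i\<in>F\<union>F'. d i * g i x)" if "x \<in> S" for x
    proof -
      have "(\<Sum>i\<in>F. c i * g i x) = (\<Sum>i\<in>F\<union>F'. (if i \<in> F then c i else 0) * g i x)"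
        using F F' by (intro sum.mono_neutral_cong_left) auto
      moreover have "(\<Sum>i\<in>F'. c' i * g i x) = (\<Sum>i\<in>F\<union>F'. (if i \<in> F' then c' i else 0) * g i x)"
        using F F' by (intro sum.mono_neutral_cong_left) auto
      ultimately show ?thesis
        using F F' that by (simp add: d_def sum.distrib[symmetric] distrib_right)
    qed
    then show ?thesis
      unfolding lin_def using F F' by (intro exI[of _ "F \<union> F'"] exI[of _ d]) auto
  qed
  have lin_gen: "lin (g i)" if "i \<in> I" for i
    unfolding lin_def using that by (intro exI[of _ "{i}"] exI[of _ "\<lambda>_. 1"]) auto
  have lin_zero: "lin (\<lambda>_. 0)"
    unfolding lin_def by (intro exI[of _ "{}"]) auto
  have lin_sum: "lin (\<lambda>x. \<Sum>i\<in>F. h i x)" if "finite F" "\<And>i. i \<in> F \<Longrightarrow> lin (h i)"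
    for h :: "'i \<Rightarrow> 'a \<Rightarrow> complex" and F
    using that by (induction F rule: finite_induct) (auto intro: lin_zero lin_add)
  have lin_mult: "lin (\<lambda>x. h x * h' x)" if h: "lin h" and h': "lin h'" for h h'
  proof -
    have gen: "lin (\<lambda>x. g i x * h x)" if A: "lin h" "i \<in> I" for h i
    proof -
      obtain F c where F: "finite F" "F \<subseteq> I" "\<forall>x\<in>S. h x = (\<Sum>j\<in>F. c j * g j x)"
        using A(1) unfolding lin_def by blast
      have "lin (\<lambda>x. \<Sum>j\<in>F. c j * (g i x * g j x))"
      proof (intro lin_sum lin_scale F)
        fix j assume "j \<in> F"
        then obtain k where "k \<in> I" "\<forall>x\<in>S. g k x = g i x * g j x"
          using mult[of i j] F A by blast
        then show "lin (\<lambda>x. g i x * g j x)"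
          using lin_cong[OF lin_gen[of k]] by simp
      qed
      then show ?thesis
        by (rule lin_cong) (use F in \<open>simp add: sum_distrib_left algebra_simps\<close>)
    qed
    obtain F c where F: "finite F" "F \<subseteq> I" "\<forall>x\<in>S. h x = (\<Sum>j\<in>F. c j * g j x)"
      using h unfolding lin_def by blast
    have "lin (\<lambda>x. \<Sum>j\<in>F. c j * (g j x * h' x))"
      using F gen[OF h'] by (intro lin_sum lin_scale) auto
    then show ?thesis
      by (rule lin_cong) (use F in \<open>simp add: sum_distrib_right mult.assoc\<close>)
  qed
  have lin_cnj: "lin (\<lambda>x. cnj (h x))" if A: "lin h" for h
  proof -
    obtain F c where F: "finite F" "F \<subseteq> I" "\<forall>x\<in>S. h x = (\<Sum>j\<in>F. c j * g j x)"
      using A unfolding lin_def by blast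
    have "lin (\<lambda>x. \<Sum>j\<in>F. cnj (c j) * cnj (g j x))"
    proof (intro lin_sum lin_scale F)
      fix j assume "j \<in> F"
      then obtain k where "k \<in> I" "\<forall>x\<in>S. g k x = cnj (g j x)"
        using cnj[of j] F by blast
      then show "lin (\<lambda>x. cnj (g j x))"
        using lin_cong[OF lin_gen[of k]] by simp
    qed
    then show ?thesis
      by (rule lin_cong) (use F in simp)
  qed
  have lin_const: "lin (\<lambda>_. a)" for a
  proof -
    obtain i where "i \<in> I" "\<forall>x\<in>S. g i x = 1" using one by blast
    then show ?thesis using lin_cong[OF lin_scale[OF lin_gen[of i], of a]] by simp
  qed
  have lin_cont: "continuous_on S h" if A: "lin h" for h
  proof -
    obtain F c where F: "finite F" "F \<subseteq> I" "\<forall>x\<in>S. h x = (\<Sum>j\<in>F. c j * g j x)"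
      using A unfolding lin_def by blast
    have "continuous_on S (\<lambda>x. \<Sum>j\<in>F. c j * g j x)"
      using F cont by (intro continuous_intros) auto
    then show ?thesis
      using F(3) by (simp cong: continuous_on_cong)
  qed
  \<comment> \<open>The real theorem is applied to the real-valued members of the span. Closure
    under conjugation puts the real and imaginary parts of the generators among them, so they still
    separate points.\<close>
  interpret function_ring_on "{h. lin (\<lambda>x. complex_of_real (h x))}" S
  proof
    fix x y assume xy: "x \<in> S" "y \<in> S" "x \<noteq> y"
    then obtain i where i: "i \<in> I" "g i x \<noteq> g i y" using sep by blast
    have "lin (\<lambda>x. (1/2) * (g i x + cnj (g i x)))"
      by (intro lin_scale lin_add lin_gen lin_cnj i)
    then have re: "lin (\<lambda>x. complex_of_real (Re (g i x)))"
      by (rule lin_cong) (simp add: complex_eq_iff)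
    have "lin (\<lambda>x. (-\<i>/2) * (g i x + (-1) * cnj (g i x)))"
      by (intro lin_scale lin_add lin_gen lin_cnj i)
    then have im: "lin (\<lambda>x. complex_of_real (Im (g i x)))"
      by (rule lin_cong) (simp add: complex_eq_iff)
    show "\<exists>f\<in>{h. lin (\<lambda>x. complex_of_real (h x))}. f x \<noteq> f y"
    proof (cases "Re (g i x) = Re (g i y)")
      case True
      then have "Im (g i x) \<noteq> Im (g i y)" using i(2) by (simp add: complex_eq_iff)
      then show ?thesis using im by (intro bexI[of _ "\<lambda>x. Im (g i x)"]) simp_all
    next
      case False
      then show ?thesis using re by (intro bexI[of _ "\<lambda>x. Re (g i x)"]) simp_all
    qed
  next
    fix f assume "f \<in> {h. lin (\<lambda>x. complex_of_real (h x))}"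
    then have "continuous_on S (\<lambda>x. Re (complex_of_real (f x)))"
      by (intro continuous_intros lin_cont) auto
    then show "continuous_on S f" by simp
  qed (use assms lin_add lin_mult lin_const in auto)
  have e2: "e / 2 > 0" using assms by simp
  obtain r where r: "lin (\<lambda>x. complex_of_real (r x))" "\<forall>x\<in>S. \<bar>Re (f x) - r x\<bar> < e/2"
    using Stone_Weierstrass_basic[OF continuous_on_Re[OF f] e2] by auto
  obtain s where s: "lin (\<lambda>x. complex_of_real (s x))" "\<forall>x\<in>S. \<bar>Im (f x) - s x\<bar> < e/2"
    using Stone_Weierstrass_basic[OF continuous_on_Im[OF f] e2] by auto
  have "lin (\<lambda>x. complex_of_real (r x) + \<i> * complex_of_real (s x))"
    by (intro lin_add lin_scale r s)
  then obtain F c where F: "finite F" "F \<subseteq> I"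
    "\<forall>x\<in>S. complex_of_real (r x) + \<i> * complex_of_real (s x) = (\<Sum>j\<in>F. c j * g j x)"
    unfolding lin_def by blast
  have "cmod (f x - (\<Sum>i\<in>F. c i * g i x)) < e" if "x \<in> S" for x
  proof -
    have "cmod (f x - (complex_of_real (r x) + \<i> * complex_of_real (s x)))
        \<le> \<bar>Re (f x) - r x\<bar> + \<bar>Im (f x) - s x\<bar>"
      by (rule order_trans[OF cmod_le]) simp
    also have "\<dots> < e" using r(2) s(2) that by force
    finally show ?thesis using F that by simp
  qed
  then show ?thesis using F by blast
qed

section \<open>The unit cube and the exponentials\<close>

definition unit_cube :: "(real^'d::finite) set" where
  "unit_cube = {v. \<forall>i. 0 \<le> v$i \<and> v$i \<le> 1}"

lemma unit_cube_eq_cbox: "unit_cube = cbox 0 (\<chi> i. 1)"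
  by (auto simp: unit_cube_def mem_box_cart)

lemma compact_unit_cube: "compact unit_cube"
  unfolding unit_cube_eq_cbox by (rule compact_cbox)

lemma closed_unit_cube: "closed unit_cube"
  by (simp add: compact_imp_closed compact_unit_cube)

lemma norm_unit_cube_le:
  fixes v :: "real^'d::finite"
  assumes "v \<in> unit_cube" shows "norm v \<le> real CARD('d)"
proof -
  have "norm v \<le> (\<Sum>i\<in>UNIV. \<bar>v$i\<bar>)" by (rule norm_le_l1_cart)
  also have "\<dots> \<le> (\<Sum>i\<in>(UNIV::'d set). 1)"
    using assms by (intro sum_mono) (auto simp: unit_cube_def)
  finally show ?thesis by simp
qed

lemma expo_0 [simp]: "expo 0 x = 1"
  by (simp add: expo_def)

lemma expo_0_right [simp]: "expo l 0 = 1"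
  by (simp add: expo_def)

lemma cmod_expo [simp]: "cmod (expo l x) = 1"
  by (simp add: expo_def)

lemma expo_add: "expo (l + l') x = expo l x * expo l' x"
  by (simp add: expo_def cis_mult inner_add_left distrib_left)

lemma expo_add_right: "expo l (x + y) = expo l x * expo l y"
  by (simp add: expo_def cis_mult inner_add_right distrib_left)

lemma expo_minus: "expo (- l) x = cnj (expo l x)"
  by (simp add: expo_def cis_cnj)

lemma expo_diff: "expo (l - l') x = expo l x * cnj (expo l' x)"
  by (metis expo_add expo_minus uminus_add_conv_diff add.commute)

lemma expo_diff_right: "expo l (x - y) = expo l x * cnj (expo l y)"
  by (simp add: expo_def cis_mult cis_cnj inner_diff_right right_diff_distrib)

lemma continuous_on_expo [continuous_intros]: "continuous_on A (expo l)"
  unfolding expo_def by (intro continuous_intros)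

lemma borel_measurable_expo [measurable]: "expo l \<in> borel_measurable borel"
  by (intro borel_measurable_continuous_onI continuous_intros)

lemma cis_2pi_eq_imp_int_diff:
  assumes "cis (2 * pi * a) = cis (2 * pi * b)"
  shows "\<exists>n::int. b = a + real_of_int n"
proof -
  have "exp (\<i> * of_real (2 * pi * b)) = exp (\<i> * of_real (2 * pi * a))"
    using assms by (simp add: cis_conv_exp)
  then obtain n :: int where
    "\<i> * of_real (2 * pi * b) = \<i> * of_real (2 * pi * a) + (of_int (2 * n) * pi) * \<i>"
    unfolding exp_eq by blast
  then have "2 * pi * b = 2 * pi * a + 2 * n * pi"
    by (simp add: complex_eq_iff)
  then have "2 * pi * b = 2 * pi * (a + n)" by (simp add: algebra_simps)
  then have "b = a + n" by (subst (asm) mult_cancel_left) simp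
  then show ?thesis by blast
qed

lemma cmod_cis_diff_le: "cmod (cis s - cis t) \<le> \<bar>s - t\<bar>"
proof -
  have "cis s - cis t = cis t * (exp (\<i> * of_real (s - t)) - 1)"
    by (simp add: cis_conv_exp right_diff_distrib exp_add[symmetric])
  then have "cmod (cis s - cis t) = 2 * \<bar>sin ((s - t) / 2)\<bar>"
    by (simp only: norm_mult norm_cis dist_exp_i_1 mult_1)
  also have "\<dots> \<le> 2 * \<bar>(s - t) / 2\<bar>"
    by (intro mult_left_mono abs_sin_x_le_abs_x) auto
  finally show ?thesis by simp
qed

lemma cmod_expo_diff_le: "cmod (expo l x - expo l' x) \<le> 2 * pi * (norm (l - l') * norm x)"
proof -
  have "cmod (expo l x - expo l' x) \<le> \<bar>2 * pi * (l \<bullet> x) - 2 * pi * (l' \<bullet> x)\<bar>"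
    unfolding expo_def by (rule cmod_cis_diff_le)
  also have "\<dots> = 2 * pi * \<bar>(l - l') \<bullet> x\<bar>"
    by (simp add: inner_diff_left abs_mult right_diff_distrib[symmetric])
  also have "\<dots> \<le> 2 * pi * (norm (l - l') * norm x)"
    by (intro mult_left_mono Cauchy_Schwarz_ineq2) auto
  finally show ?thesis .
qed

lemma int_vec_add: "int_vec (k + l) = int_vec k + int_vec l"
  by (simp add: int_vec_def vec_eq_iff)

lemma int_vec_diff: "int_vec (k - l) = int_vec k - int_vec l"
  by (simp add: int_vec_def vec_eq_iff)

lemma int_vec_minus: "int_vec (- k) = - int_vec k"
  by (simp add: int_vec_def vec_eq_iff)

lemma int_vec_0 [simp]: "int_vec 0 = 0"
  by (simp add: int_vec_def vec_eq_iff)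

lemma int_vec_nth [simp]: "int_vec k $ i = real_of_int (k $ i)"
  by (simp add: int_vec_def)

lemma expo_int_vec_int_vec: "expo (int_vec k) (int_vec l) = 1"
proof -
  have "int_vec k \<bullet> int_vec l = real_of_int (\<Sum>i\<in>UNIV. k$i * l$i)"
    by (simp add: inner_vec_def)
  then show ?thesis
    unfolding expo_def by (simp only: cis_multiple_2pi Ints_of_int)
qed

lemma trig_poly_approx_cube:
  fixes f :: "real^'d::finite \<Rightarrow> complex"
  assumes "continuous_on unit_cube f" "0 < (e::real)"
  shows "\<exists>F c. finite F \<and> (\<forall>x\<in>unit_cube. cmod (f x - (\<Sum>l\<in>F. c l * expo l x)) < e)"
proof -
  have "\<exists>F c. finite F \<and> F \<subseteq> UNIV \<and> (\<forall>x\<in>unit_cube. cmod (f x - (\<Sum>l\<in>F. c l * expo l x)) < e)"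
  proof (rule complex_Stone_Weierstrass)
    fix x y :: "real^'d" assume "x \<noteq> y"
    \<comment> \<open>The frequency is scaled so that the phases at \<open>x\<close> and
      \<open>y\<close> differ by half a turn. Integer frequencies could not separate opposite faces
      of the cube.\<close>
    define l where "l = (1 / (2 * (norm (x - y))\<^sup>2)) *\<^sub>R (x - y)"
    have "l \<bullet> (x - y) = 1/2"
      using \<open>x \<noteq> y\<close> by (simp add: l_def power2_norm_eq_inner)
    then have "expo l (x - y) = -1"
      unfolding expo_def by (simp only:) simp
    then have "expo l x \<noteq> expo l y"
      by (auto simp: expo_diff_right complex_norm_square[symmetric])
    then show "\<exists>i\<in>UNIV. expo i x \<noteq> expo i y" by blast
  next
    fix i j :: "real^'d"
    show "\<exists>k\<in>UNIV. \<forall>x\<in>unit_cube. expo k x = expo i x * expo j x"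
      by (rule bexI[of _ "i + j"]) (auto simp: expo_add)
    show "\<exists>k\<in>UNIV. \<forall>x\<in>unit_cube. expo k x = cnj (expo i x)"
      by (rule bexI[of _ "- i"]) (auto simp: expo_minus)
  next
    show "\<exists>i\<in>UNIV. \<forall>x\<in>unit_cube. expo i x = 1"
      by (rule bexI[of _ 0]) auto
  qed (use assms compact_unit_cube in \<open>auto intro: continuous_intros\<close>)
  then show ?thesis by blast
qed

text \<open>The torus is realised as the image of the cube under the coordinatewise map to the unit
  circle; a function on the cube that respects the identification of opposite faces descends to a
  continuous function there because its graph is compact.\<close>

lemma trig_poly_approx_periodic:
  fixes f :: "real^'d::finite \<Rightarrow> complex"
  assumes cont: "continuous_on unit_cube f" and "0 < (e::real)"
    and per: "\<And>x y. x \<in> unit_cube \<Longrightarrow> y \<in> unit_cube \<Longrightarrow>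
                (\<forall>i. cis (2 * pi * x$i) = cis (2 * pi * y$i)) \<Longrightarrow> f x = f y"
  shows "\<exists>F c. finite F \<and> (\<forall>x\<in>unit_cube. cmod (f x - (\<Sum>k\<in>F. c k * expo (int_vec k) x)) < e)"
proof -
  define E :: "real^'d \<Rightarrow> complex^'d" where "E v = (\<chi> i. cis (2 * pi * v$i))" for v
  define T where "T = E ` unit_cube"
  define r where "r = inv_into unit_cube E"
  have contE: "continuous_on unit_cube E"
    unfolding E_def by (intro continuous_intros)
  have r: "r z \<in> unit_cube" "E (r z) = z" if "z \<in> T" for z
    using that unfolding T_def r_def by (auto simp: inv_into_into f_inv_into_f)
  have descend: "continuous_on T (\<lambda>z. h (r z)) \<and> (\<forall>v\<in>unit_cube. h (r (E v)) = h v)"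
    if h: "continuous_on unit_cube h"
      and per: "\<And>x y. x \<in> unit_cube \<Longrightarrow> y \<in> unit_cube \<Longrightarrow> E x = E y \<Longrightarrow> h x = h y"
    for h :: "real^'d \<Rightarrow> complex"
  proof
    show *: "\<forall>v\<in>unit_cube. h (r (E v)) = h v"
    proof
      fix v :: "real^'d" assume "v \<in> unit_cube"
      then have "E v \<in> T" by (simp add: T_def)
      then show "h (r (E v)) = h v"
        using r[of "E v"] per[of "r (E v)" v] \<open>v \<in> unit_cube\<close> by simp
    qed
    have "(\<lambda>z. (z, h (r z))) ` T = (\<lambda>v. (E v, h v)) ` unit_cube"
      unfolding T_def image_image using * by (intro image_cong) auto
    moreover have "compact ((\<lambda>v. (E v, h v)) ` unit_cube)"
      by (intro compact_continuous_image continuous_intros contE h compact_unit_cube)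
    ultimately show "continuous_on T (\<lambda>z. h (r z))"
      using r(1) h
      by (intro continuous_from_closed_graph[of "h ` unit_cube"])
         (auto intro: compact_continuous_image compact_unit_cube compact_imp_closed)
  qed
  have expo_E: "expo (int_vec k) x = expo (int_vec k) y" if "E x = E y" for k :: "int^'d" and x y
  proof -
    have "\<exists>n. y$i = x$i + real_of_int n" for i
      using \<open>E x = E y\<close> by (intro cis_2pi_eq_imp_int_diff) (simp add: E_def vec_eq_iff)
    then obtain n where "\<And>i. y$i = x$i + real_of_int (n i)" by metis
    then have "y = x + int_vec (\<chi> i. n i)" by (simp add: vec_eq_iff)
    then show ?thesis by (simp add: expo_add_right expo_int_vec_int_vec)
  qed
  have f_E: "f x = f y" if xy: "x \<in> unit_cube" "y \<in> unit_cube" and "E x = E y" for x y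
    using \<open>E x = E y\<close> by (intro per xy) (simp add: E_def vec_eq_iff)
  have "continuous_on T (\<lambda>z. f (r z)) \<and> (\<forall>v\<in>unit_cube. f (r (E v)) = f v)"
    by (rule descend) (fact cont, fact f_E)
  then have f_r: "continuous_on T (\<lambda>z. f (r z))" "\<forall>v\<in>unit_cube. f (r (E v)) = f v"
    by (fact conjunct1, fact conjunct2)
  have expo_r: "continuous_on T (\<lambda>z. expo (int_vec k) (r z))" for k
    by (rule conjunct1, rule descend[of "expo (int_vec k)"]) (rule continuous_on_expo, erule expo_E)
  have "\<exists>F c. finite F \<and> F \<subseteq> UNIV \<and>
          (\<forall>z\<in>T. cmod (f (r z) - (\<Sum>k\<in>F. c k * expo (int_vec k) (r z))) < e)"
  proof (rule complex_Stone_Weierstrass)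
    show "compact T" unfolding T_def by (intro compact_continuous_image contE compact_unit_cube)
  next
    fix k l :: "int^'d"
    show "\<exists>j\<in>UNIV. \<forall>z\<in>T. expo (int_vec j) (r z) = expo (int_vec k) (r z) * expo (int_vec l) (r z)"
      by (rule bexI[of _ "k + l"]) (auto simp: expo_add int_vec_add)
    show "\<exists>j\<in>UNIV. \<forall>z\<in>T. expo (int_vec j) (r z) = cnj (expo (int_vec k) (r z))"
      by (rule bexI[of _ "- k"]) (auto simp: expo_minus int_vec_minus)
  next
    show "\<exists>j\<in>UNIV. \<forall>z\<in>T. expo (int_vec j) (r z) = 1"
      by (rule bexI[of _ 0]) auto
  next
    fix z w assume zw: "z \<in> T" "w \<in> T" "z \<noteq> w"
    then obtain i where i: "z$i \<noteq> w$i" by (auto simp: vec_eq_iff)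
    have "expo (int_vec (axis i 1)) (r u) = u$i" if "u \<in> T" for u
    proof -
      have "int_vec (axis i 1) = (axis i 1 :: real^'d)"
        by (simp add: vec_eq_iff axis_def)
      then have "expo (int_vec (axis i 1)) (r u) = E (r u) $ i"
        by (simp add: expo_def E_def inner_axis' )
      then show ?thesis using r(2)[OF that] by simp
    qed
    then show "\<exists>k\<in>UNIV. expo (int_vec k) (r z) \<noteq> expo (int_vec k) (r w)"
      using zw i by (intro bexI[of _ "axis i 1"]) auto
  qed (rule expo_r f_r(1) \<open>0 < e\<close>)+
  then obtain F c where F: "finite F"
    "\<And>z. z \<in> T \<Longrightarrow> cmod (f (r z) - (\<Sum>k\<in>F. c k * expo (int_vec k) (r z))) < e"
    by blast
  have "cmod (f x - (\<Sum>k\<in>F. c k * expo (int_vec k) x)) < e" if x: "x \<in> unit_cube" for x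
  proof -
    have Ex: "E x \<in> T" using x by (simp add: T_def)
    have "f (r (E x)) = f x"
      using f_r(2) x by (rule bspec)
    moreover have "expo (int_vec k) (r (E x)) = expo (int_vec k) x" for k
      using expo_E r(2)[OF Ex] by blast
    ultimately show ?thesis using F(2)[OF Ex] by simp
  qed
  then show ?thesis using F(1) by blast
qed

section \<open>Cancellation between digit translates\<close>

text \<open>Among the \<open>CARD('d) + 1\<close> times from 0 to \<open>CARD('d)\<close>, two times
  t < u wrap the same coordinate. It restarts at 0 at time t + 1 and has climbed to at most u - t -
  1 \<le> \<open>CARD('d) - 1\<close> at time u, whereas the second wrap requires height
  \<open>m i - 1\<close>, which is at least \<open>CARD('d)\<close>.\<close>

lemma wrapping_coordinates_contradiction:
  fixes h :: "nat \<Rightarrow> 'd::finite \<Rightarrow> int" and m :: "'d \<Rightarrow> nat"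
  assumes big: "\<And>i. CARD('d) + 1 \<le> m i"
    and step: "\<And>t i. h (Suc t) i \<le> h t i + 1"
    and wrap: "\<And>t. \<exists>i. h t i = int (m i) - 1 \<and> h (Suc t) i = 0"
  shows False
proof -
  obtain w where w: "\<And>t. h t (w t) = int (m (w t)) - 1" "\<And>t. h (Suc t) (w t) = 0"
    using wrap by metis
  have "card (w ` {..CARD('d)}) \<le> CARD('d)"
    by (rule card_mono) auto
  then have "\<not> inj_on w {..CARD('d)}"
    by (intro pigeonhole) simp
  then obtain t u where tu: "t \<le> CARD('d)" "u \<le> CARD('d)" "w t = w u" "t < u"
    unfolding inj_on_def by (metis atMost_iff linorder_neqE_nat)
  have "h (Suc t + n) (w t) \<le> int n" for n
    by (induction n) (use w(2)[of t] step in \<open>auto intro: order_trans[OF step]\<close>)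
  from this[of "u - Suc t"] have "h u (w t) \<le> int (u - Suc t)"
    using tu by simp
  moreover have "h u (w t) = int (m (w t)) - 1"
    using w(1)[of u] tu by simp
  ultimately show False
    using big[of "w t"] tu by linarith
qed

text \<open>A mass \<open>P s > 0\<close> carried by the translate with digit \<open>b\<close> can only be cancelled on the torus
  by a translate with some other digit \<open>b'\<close>, and then some coordinate wraps around from one face of
  the cube to the opposite one. Iterating, every coordinate moves at most one unit per step in a
  fixed direction, so it needs \<open>m i\<close> steps between two wraps.\<close>

lemma digit_translates_not_cancelling:
  fixes P :: "int^'d::finite \<Rightarrow> real" and m :: "'d \<Rightarrow> nat" and \<theta> :: "('d \<Rightarrow> int) \<Rightarrow> complex"
  assumes inD: "in_D m B" and "finite B" and big: "\<And>i. CARD('d) + 1 \<le> m i"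
    and P_nonneg: "\<And>z. 0 \<le> P z"
    and P_supp: "\<And>z i. P z \<noteq> 0 \<Longrightarrow> z$i \<in> {0, 1}"
    and "0 < \<alpha>" "\<alpha> \<le> P s"
    and Q: "\<And>z. Q z = (\<Sum>b\<in>B. P (z - b)) / real (card B)"
    and \<theta>: "\<And>e. cmod (\<theta> e) = 1"
    and small: "\<And>y. (\<forall>i. 0 \<le> y$i \<and> y$i < int (m i)) \<Longrightarrow>
      cmod (\<Sum>e\<in>UNIV \<rightarrow>\<^sub>E {0, 1}. \<theta> e * complex_of_real (Q (\<chi> i. y$i + int (m i) * e i))) < \<alpha> / real (card B)"
  shows False
proof -
  have B: "B \<noteq> {}" "\<And>b i. b \<in> B \<Longrightarrow> 0 \<le> b$i \<and> b$i < int (m i)" and m2: "\<And>i. 2 \<le> m i"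
    using inD unfolding in_D_def by blast+
  have s: "s$i \<in> {0, 1}" for i
    using P_supp[of s] \<open>0 < \<alpha>\<close> \<open>\<alpha> \<le> P s\<close> by force
  have cardB: "0 < real (card B)"
    using \<open>finite B\<close> B(1) by (simp add: card_gt_0_iff)
  \<comment> \<open>\<open>H\<close> measures each digit along the direction fixed by
    \<open>s\<close>. With this orientation, passing to a cancelling digit raises a coordinate by at
    most 1, and both kinds of face crossing (from \<open>m i - 1\<close> to 0 and from 0 to
    \<open>m i - 1\<close>) become a drop from \<open>m i - 1\<close> to 0.\<close>
  define H where "H b i = (if s$i = 1 then b$i else int (m i) - 1 - b$i)" for b :: "int^'d" and i
  have step: "\<exists>b'. b' \<in> B \<and> ((\<forall>i. H b' i \<le> H b i + 1) \<and> (\<exists>i. H b i = int (m i) - 1 \<and> H b' i = 0))"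
    if b: "b \<in> B" for b
  proof -
    \<comment> \<open>This reduces the cell \<open>b + s\<close> modulo \<open>m\<close>:
      \<open>e i = 1\<close> exactly when the cell lies on the far face, that is,
      \<open>b$i = m i - 1\<close> and \<open>s$i = 1\<close>.\<close>
    define e where "e i = (if b$i + s$i = int (m i) then 1 else 0 :: int)" for i
    define y where "y = (\<chi> i. b$i + s$i - int (m i) * e i)"
    have y: "0 \<le> y$i \<and> y$i < int (m i)" for i
      using B(2)[OF b, of i] s[of i] unfolding y_def e_def by auto
    let ?z = "\<lambda>e. (\<chi> i. y$i + int (m i) * e i)"
    have ze: "?z e = b + s"
      by (simp add: vec_eq_iff y_def)
    have e: "e \<in> UNIV \<rightarrow>\<^sub>E {0, 1}"
      by (auto simp: e_def split: if_splits)
    have "P s \<le> (\<Sum>b'\<in>B. P (b + s - b'))"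
      using member_le_sum[of b B "\<lambda>b'. P (b + s - b')"] b \<open>finite B\<close> P_nonneg by simp
    then have Qbs: "\<alpha> / real (card B) \<le> Q (b + s)"
      unfolding Q using \<open>\<alpha> \<le> P s\<close> by (intro divide_right_mono) auto
    \<comment> \<open>A cell alone in its residue class would make the sum have modulus
      \<open>Q (b + s)\<close>, at least \<alpha> / \<open>card B\<close>, against
      \<open>small\<close>.\<close>
    have "\<exists>e'\<in>UNIV \<rightarrow>\<^sub>E {0, 1}. e' \<noteq> e \<and> Q (?z e') \<noteq> 0"
    proof (rule ccontr)
      assume "\<not> ?thesis"
      then have "(\<Sum>e'\<in>UNIV \<rightarrow>\<^sub>E {0, 1}. \<theta> e' * complex_of_real (Q (?z e')))
          = (\<Sum>e'\<in>{e}. \<theta> e' * complex_of_real (Q (?z e')))"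
        using e by (intro sum.mono_neutral_right) (auto intro: finite_PiE)
      then have "cmod (\<Sum>e'\<in>UNIV \<rightarrow>\<^sub>E {0, 1}. \<theta> e' * complex_of_real (Q (?z e'))) = \<bar>Q (b + s)\<bar>"
        by (simp add: ze norm_mult \<theta>)
      then show False
        using small[of y] y Qbs by auto
    qed
    then obtain e' where e': "e' \<in> UNIV \<rightarrow>\<^sub>E {0, 1}" "e' \<noteq> e" "Q (?z e') \<noteq> 0"
      by blast
    have "(\<Sum>b\<in>B. P (?z e' - b)) \<noteq> 0"
      using e'(3) unfolding Q by auto
    then obtain b' where b': "b' \<in> B" "P (?z e' - b') \<noteq> 0"
      using sum.neutral by meson
    have eq: "b$i + s$i = y$i + int (m i) * e i" for i
      by (simp add: y_def)
    have s': "y$i + int (m i) * e' i - b'$i \<in> {0, 1}" for i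
      using P_supp[OF b'(2), of i] by simp
    have e01: "e i \<in> {0, 1}" "e' i \<in> {0, 1}" for i
      using e e'(1) by (auto dest: PiE_mem)
    \<comment> \<open>Where \<open>e\<close> and \<open>e'\<close> agree, the digits differ by a
      difference of two offsets in {0, 1}, and the known offset \<open>s$i\<close> decides in which
      direction they can move. Where they differ, the two cells lie on opposite faces, which forces
      both digits to be extreme.\<close>
    have "H b' i \<le> H b i + 1" for i
      using eq[of i] s'[of i] e01[of i] s[of i] B(2)[OF b, of i] B(2)[OF b'(1), of i] m2[of i]
      unfolding H_def by (auto split: if_splits)
    moreover have "\<exists>i. H b i = int (m i) - 1 \<and> H b' i = 0"
    proof -
      obtain i where "e' i \<noteq> e i" using e'(2) by blast
      then have "H b i = int (m i) - 1 \<and> H b' i = 0"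
        using eq[of i] s'[of i] e01[of i] s[of i] B(2)[OF b, of i] B(2)[OF b'(1), of i] m2[of i]
        unfolding H_def by (auto split: if_splits)
      then show ?thesis by blast
    qed
    ultimately show ?thesis using b'(1) by blast
  qed
  obtain b0 where "b0 \<in> B" using B(1) by blast
  then obtain f where f: "\<And>n. f n \<in> B"
    "\<And>n. (\<forall>i. H (f (Suc n)) i \<le> H (f n) i + 1) \<and> (\<exists>i. H (f n) i = int (m i) - 1 \<and> H (f (Suc n)) i = 0)"
    using dependent_nat_choice[of "\<lambda>_ b. b \<in> B"
        "\<lambda>_ b b'. (\<forall>i. H b' i \<le> H b i + 1) \<and> (\<exists>i. H b i = int (m i) - 1 \<and> H b' i = 0)"] step
    by metis
  show False
    by (rule wrapping_coordinates_contradiction[of m "\<lambda>n. H (f n)"]) (use big f(2) in auto)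
qed

text \<open>Truncated tails have finite support, so they are modelled as pmfs, for which every
  function is integrable. Here \<open>p\<close> stands for everything after the first layer; all
  that will be used about it is finite support inside the cube.\<close>

definition digit_law :: "('d::finite \<Rightarrow> nat) \<Rightarrow> (int^'d) set \<Rightarrow> (real^'d) pmf \<Rightarrow> (real^'d) pmf" where
  "digit_law m B p =
     pmf_of_set B \<bind> (\<lambda>b. map_pmf (\<lambda>v. \<chi> i. (real_of_int (b$i) + v$i) / real (m i)) p)"

lemma in_D_finite:
  assumes "in_D m (B :: (int^'d::finite) set)" shows "finite B"
proof -
  have "B \<subseteq> (\<lambda>f. \<chi> i. f i) ` (PiE UNIV (\<lambda>i. {0..<int (m i)}))"
  proof
    fix b assume "b \<in> B"
    then have "(\<lambda>i. b$i) \<in> PiE UNIV (\<lambda>i. {0..<int (m i)})"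
      using assms by (auto simp: in_D_def)
    moreover have "b = (\<chi> i. b$i)" by simp
    ultimately show "b \<in> (\<lambda>f. \<chi> i. f i) ` (PiE UNIV (\<lambda>i. {0..<int (m i)}))" by blast
  qed
  then show ?thesis
    by (rule finite_subset) (intro finite_imageI finite_PiE, auto)
qed

lemma in_D_card_pos:
  assumes "in_D m B" shows "0 < card B"
  using assms in_D_finite[OF assms] by (auto simp: in_D_def card_gt_0_iff)

lemma expectation_digit_law:
  fixes f :: "real^'d::finite \<Rightarrow> 'b::{banach, second_countable_topology}"
  assumes "in_D m B" "finite (set_pmf p)"
  shows "measure_pmf.expectation (digit_law m B p) f =
    (\<Sum>b\<in>B. measure_pmf.expectation p (\<lambda>v. f (\<chi> i. (real_of_int (b$i) + v$i) / real (m i)))) /\<^sub>R real (card B)"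
  unfolding digit_law_def using assms in_D_finite[OF assms(1)]
  by (subst pmf_expectation_bind_pmf_of_set) (auto simp: in_D_def scaleR_sum_right)

lemma finite_set_digit_law:
  assumes "in_D m B" "finite (set_pmf p)"
  shows "finite (set_pmf (digit_law m B p))"
  unfolding digit_law_def using assms in_D_finite[OF assms(1)] by (auto simp: in_D_def)

lemma set_digit_law_subset_unit_cube:
  assumes "in_D m B" "set_pmf p \<subseteq> unit_cube"
  shows "set_pmf (digit_law m B p) \<subseteq> unit_cube"
proof
  fix u assume "u \<in> set_pmf (digit_law m B p)"
  then obtain b v where bv: "b \<in> B" "v \<in> unit_cube"
    "u = (\<chi> i. (real_of_int (b$i) + v$i) / real (m i))"
    using assms in_D_finite[OF assms(1)] by (auto simp: digit_law_def in_D_def)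
  have "0 \<le> u$i \<and> u$i \<le> 1" for i
  proof -
    have "0 \<le> b$i" "b$i \<le> int (m i) - 1" "2 \<le> m i"
      using assms(1) bv(1) by (auto simp: in_D_def)
    then have "0 \<le> real_of_int (b$i)" "real_of_int (b$i) \<le> real (m i) - 1" "0 < real (m i)"
      by linarith+
    then show ?thesis
      using bv(2)[unfolded unit_cube_def, simplified, THEN spec, of i] unfolding bv(3)
      by (simp add: divide_simps)
  qed
  then show "u \<in> unit_cube" by (simp add: unit_cube_def)
qed

lemma cmod_expectation_le:
  fixes f :: "'a \<Rightarrow> complex"
  assumes "finite (set_pmf p)" "\<And>x. x \<in> set_pmf p \<Longrightarrow> cmod (f x) \<le> a"
  shows "cmod (measure_pmf.expectation p f) \<le> a"
proof -
  have "cmod (measure_pmf.expectation p f) \<le> measure_pmf.expectation p (\<lambda>x. cmod (f x))"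
    by (rule integral_norm_bound)
  also have "\<dots> \<le> measure_pmf.expectation p (\<lambda>_. a)"
    using assms by (intro integral_mono_AE integrable_measure_pmf_finite) (auto simp: AE_measure_pmf_iff)
  finally show ?thesis by simp
qed

text \<open>The cube bounds \<open>norm v\<close> by the dimension, so the Lipschitz constant does
  not depend on the law. Every later perturbation of a frequency relies on this uniformity.\<close>

lemma cmod_expectation_expo_diff_le:
  fixes p :: "(real^'d::finite) pmf"
  assumes "finite (set_pmf p)" "set_pmf p \<subseteq> unit_cube"
  shows "cmod (measure_pmf.expectation p (expo \<xi>) - measure_pmf.expectation p (expo \<eta>))
          \<le> 2 * pi * real CARD('d) * norm (\<xi> - \<eta>)"
proof -
  have "measure_pmf.expectation p (expo \<xi>) - measure_pmf.expectation p (expo \<eta>)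
      = measure_pmf.expectation p (\<lambda>v. expo \<xi> v - expo \<eta> v)"
    by (intro Bochner_Integration.integral_diff[symmetric] integrable_measure_pmf_finite assms)
  moreover have "cmod \<dots> \<le> 2 * pi * real CARD('d) * norm (\<xi> - \<eta>)"
  proof (rule cmod_expectation_le[OF assms(1)])
    fix v assume "v \<in> set_pmf p"
    then have "norm v \<le> real CARD('d)" using assms(2) norm_unit_cube_le by blast
    then have "2 * pi * (norm (\<xi> - \<eta>) * norm v) \<le> 2 * pi * (norm (\<xi> - \<eta>) * real CARD('d))"
      by (intro mult_left_mono) auto
    also have "\<dots> = 2 * pi * real CARD('d) * norm (\<xi> - \<eta>)" by simp
    finally show "cmod (expo \<xi> v - expo \<eta> v) \<le> 2 * pi * real CARD('d) * norm (\<xi> - \<eta>)"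
      using cmod_expo_diff_le[of \<xi> v \<eta>] by linarith
  qed
  ultimately show ?thesis by simp
qed

text \<open>A quantitative form of the uniqueness theorem on the torus for the complex measure
  \<open>expo x\<close> dq. Approximating \<open>f\<close> by one trigonometric polynomial fixes
  both \<delta> and the finite set of test frequencies before \<open>q\<close> is chosen.\<close>

lemma small_coefficients_imp_small_expectation:
  fixes f :: "real^'d::finite \<Rightarrow> complex"
  assumes cont: "continuous_on unit_cube f" and "0 < (\<eta>::real)"
    and per: "\<And>x y. x \<in> unit_cube \<Longrightarrow> y \<in> unit_cube \<Longrightarrow>
                (\<forall>i. cis (2 * pi * x$i) = cis (2 * pi * y$i)) \<Longrightarrow> f x = f y"
  shows "\<exists>\<delta>>0. \<exists>K. finite K \<and> (\<forall>q. finite (set_pmf q) \<longrightarrow> set_pmf q \<subseteq> unit_cube \<longrightarrow>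
           (\<forall>k\<in>K. cmod (measure_pmf.expectation q (expo (x + int_vec k))) < \<delta>) \<longrightarrow>
           cmod (measure_pmf.expectation q (\<lambda>v. f v * expo x v)) < \<eta>)"
proof -
  obtain F c where F: "finite F"
    "\<And>v. v \<in> unit_cube \<Longrightarrow> cmod (f v - (\<Sum>k\<in>F. c k * expo (int_vec k) v)) < \<eta> / 2"
  proof -
    have "\<exists>F c. finite F \<and> (\<forall>v\<in>unit_cube. cmod (f v - (\<Sum>k\<in>F. c k * expo (int_vec k) v)) < \<eta> / 2)"
      by (rule trig_poly_approx_periodic[OF cont]) (use \<open>0 < \<eta>\<close> in simp, fact per)
    then show ?thesis using that by blast
  qed
  \<comment> \<open>The summand 1 keeps \<open>C\<close> positive even if all coefficients vanish,
    and makes the estimate (C - 1) \<delta> < C \<delta> strict.\<close>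
  define C where "C = 1 + (\<Sum>k\<in>F. cmod (c k))"
  have C: "0 < C" unfolding C_def by (intro add_pos_nonneg sum_nonneg) auto
  define \<delta> where "\<delta> = \<eta> / (2 * C)"
  have "cmod (measure_pmf.expectation q (\<lambda>v. f v * expo x v)) < \<eta>"
    if q: "finite (set_pmf q)" "set_pmf q \<subseteq> unit_cube"
      and small: "\<forall>k\<in>F. cmod (measure_pmf.expectation q (expo (x + int_vec k))) < \<delta>" for q
  proof -
    have int: "integrable (measure_pmf q) g" for g :: "real^'d \<Rightarrow> complex"
      by (rule integrable_measure_pmf_finite[OF q(1)])
    let ?T = "\<lambda>v. \<Sum>k\<in>F. c k * expo (int_vec k) v"
    have "measure_pmf.expectation q (\<lambda>v. f v * expo x v)
        = measure_pmf.expectation q (\<lambda>v. (f v - ?T v) * expo x v + (\<Sum>k\<in>F. c k * expo (x + int_vec k) v))"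
      by (intro Bochner_Integration.integral_cong refl)
         (simp add: expo_add algebra_simps sum_distrib_left)
    also have "\<dots> = measure_pmf.expectation q (\<lambda>v. (f v - ?T v) * expo x v)
        + (\<Sum>k\<in>F. c k * measure_pmf.expectation q (expo (x + int_vec k)))"
      by (simp add: int)
    finally have "cmod (measure_pmf.expectation q (\<lambda>v. f v * expo x v)) \<le>
        cmod (measure_pmf.expectation q (\<lambda>v. (f v - ?T v) * expo x v))
        + cmod (\<Sum>k\<in>F. c k * measure_pmf.expectation q (expo (x + int_vec k)))"
      by (simp add: norm_triangle_ineq)
    moreover have "cmod (measure_pmf.expectation q (\<lambda>v. (f v - ?T v) * expo x v)) \<le> \<eta> / 2"
      using q F(2) by (intro cmod_expectation_le) (auto simp: norm_mult intro: less_imp_le)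
    moreover have "cmod (\<Sum>k\<in>F. c k * measure_pmf.expectation q (expo (x + int_vec k))) < \<eta> / 2"
    proof -
      have "cmod (\<Sum>k\<in>F. c k * measure_pmf.expectation q (expo (x + int_vec k)))
          \<le> (\<Sum>k\<in>F. cmod (c k) * \<delta>)"
        using small by (intro sum_norm_le) (simp add: norm_mult mult_left_mono less_imp_le)
      also have "\<dots> = (C - 1) * \<delta>"
        by (simp add: C_def sum_distrib_right)
      also have "\<dots> < C * \<delta>"
        using C \<open>0 < \<eta>\<close> by (intro mult_strict_right_mono) (auto simp: \<delta>_def)
      also have "\<dots> = \<eta> / 2"
        using C by (simp add: \<delta>_def)
      finally show ?thesis .
    qed
    ultimately show ?thesis by linarith
  qed
  moreover have "0 < \<delta>" using C \<open>0 < \<eta>\<close> by (simp add: \<delta>_def)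
  ultimately show ?thesis using F(1) by blast
qed

section \<open>A uniform lower bound for Fourier coefficients\<close>

text \<open>A bump of radius 1/2: narrow enough to vanish on the wrapped copies at the faces, wide
  enough that the centres 0, 1/2 and 1 give a partition of unity on [0, 1].\<close>

definition tent :: "real \<Rightarrow> real" where
  "tent t = max 0 (1 - 2 * \<bar>t\<bar>)"

lemma tent_nonneg: "0 \<le> tent t"
  by (simp add: tent_def)

lemma tent_eq_0: "1 / 2 \<le> \<bar>t\<bar> \<Longrightarrow> tent t = 0"
  by (simp add: tent_def)

lemma tent_partition: "0 \<le> t \<Longrightarrow> t \<le> 1 \<Longrightarrow> tent t + (tent (t - 1 / 2) + tent (t - 1)) = 1"
  by (auto simp: tent_def max_def abs_if)

lemma continuous_on_tent [continuous_intros]: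
  "continuous_on A f \<Longrightarrow> continuous_on A (\<lambda>x. tent (f x))"
  unfolding tent_def by (intro continuous_intros)

lemma cis_sum: "cis (\<Sum>i\<in>A. f i) = (\<Prod>i\<in>A. cis (f i))"
  by (cases "finite A") (induction A rule: finite_induct, auto simp: cis_mult[symmetric])

text \<open>The test functions are torus bumps indexed by a centre \<open>c\<close> and a residue
  \<open>y\<close>, finitely many pairs chosen without reference to \<open>p\<close>. If all
  coefficients at their test frequencies were too small, every bump would have a small twisted
  integral, which is the situation excluded by
  \<open>digit_translates_not_cancelling\<close>.\<close>

lemma digit_law_coefficient_bound_pointwise:
  fixes m :: "'d::finite \<Rightarrow> nat" and x :: "real^'d"
  assumes inD: "in_D m B" and big: "\<And>i. CARD('d) + 1 \<le> m i"
  shows "\<exists>\<delta>>0. \<exists>K. finite K \<and> (\<forall>p. finite (set_pmf p) \<longrightarrow> set_pmf p \<subseteq> unit_cube \<longrightarrow>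
           (\<exists>k\<in>K. \<delta> \<le> cmod (measure_pmf.expectation (digit_law m B p) (expo (x + int_vec k)))))"
proof -
  have m2: "2 \<le> m i" for i using inD by (simp add: in_D_def)
  have m0: "m i \<noteq> 0" for i using m2[of i] by linarith
  \<comment> \<open>One coordinate of a bump on the torus; \<open>e\<close> runs over the copy in
    place and the copy wrapped around. The \<open>cis\<close> factor undoes the phase of
    \<open>expo x\<close> on each copy up to a constant depending only on \<open>e\<close>, so that
    the product with \<open>expo x\<close> becomes a sum of nonnegative bumps with the unimodular
    weights \<theta>.\<close>
  define \<psi> where "\<psi> c y i t = (\<Sum>e\<in>{0, 1::int}. complex_of_real (tent (real (m i) * (t - e) - y - c))
      * cis (- (2 * pi * x$i * (t - e))))" for c y i and t :: real
  define f where "f c y v = (\<Prod>i\<in>UNIV. \<psi> (c i) (real_of_int (y$i)) i (v$i))"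
    for c and y :: "int^'d" and v :: "real^'d"
  \<comment> \<open>Some bump out of the \<open>3 ^ CARD('d)\<close> in the partition of unity
    carries at least the average mass of \<open>p\<close>, and a single digit has probability 1 /
    \<open>card B\<close>.\<close>
  define \<alpha> where "\<alpha> = 1 / 3 ^ CARD('d) / real (card B)"
  have "0 < \<alpha>" using in_D_card_pos[OF inD] by (simp add: \<alpha>_def)
  define \<theta> where "\<theta> e = (\<Prod>i\<in>UNIV. cis (2 * pi * x$i * real_of_int (e i)))" for e :: "'d \<Rightarrow> int"
  define J where "J = ((UNIV::'d set) \<rightarrow>\<^sub>E {0, 1/2::real}) \<times> {y::int^'d. \<forall>i. 0 \<le> y$i \<and> y$i < int (m i)}"
  have "finite J"
  proof -
    have "in_D m {y::int^'d. \<forall>i. 0 \<le> y$i \<and> y$i < int (m i)}"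
    proof -
      have "0 < int (m i)" for i using m2[of i] by linarith
      then have "(0::int^'d) \<in> {y. \<forall>i. 0 \<le> y$i \<and> y$i < int (m i)}" by simp
      then show ?thesis unfolding in_D_def using m2 by blast
    qed
    then have "finite {y::int^'d. \<forall>i. 0 \<le> y$i \<and> y$i < int (m i)}"
      by (rule in_D_finite)
    moreover have "finite ((UNIV::'d set) \<rightarrow>\<^sub>E {0, 1/2::real})"
      by (intro finite_PiE) simp_all
    ultimately show ?thesis unfolding J_def by (rule finite_cartesian_product[rotated])
  qed
  define good where "good j \<delta> K \<longleftrightarrow> 0 < \<delta> \<and> finite K \<and>
      (\<forall>q. finite (set_pmf q) \<longrightarrow> set_pmf q \<subseteq> unit_cube \<longrightarrow>
           (\<forall>k\<in>K. cmod (measure_pmf.expectation q (expo (x + int_vec k))) < \<delta>) \<longrightarrow>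
           cmod (measure_pmf.expectation q (\<lambda>v. f (fst j) (snd j) v * expo x v)) < \<alpha>)" for j \<delta> K
  have "\<exists>\<delta> K. good j \<delta> K" if j: "j \<in> J" for j
  proof -
    obtain c y where cy: "j = (c, y)" "\<And>i. c i \<in> {0, 1/2}" "\<And>i. 0 \<le> y$i \<and> y$i < int (m i)"
      using j unfolding J_def by (auto simp: PiE_iff)
    \<comment> \<open>At either endpoint only the copy belonging to that endpoint can be nonzero.
      The other copy is at distance at least 1/2 because \<open>c i\<close> \<le> 1/2; a centre with
      \<open>c i = 1\<close> would break periodicity.\<close>
    have \<psi>01: "\<psi> (c i) (real_of_int (y$i)) i 0 = \<psi> (c i) (real_of_int (y$i)) i 1" for i
    proof -
      have "0 \<le> real_of_int (y$i)" "real_of_int (y$i) + 1 \<le> real (m i)"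
        using cy(3)[of i] by linarith+
      moreover have "0 \<le> c i" "c i \<le> 1/2" using cy(2)[of i] by auto
      ultimately have "tent (- real (m i) - real_of_int (y$i) - c i) = 0"
        "tent (real (m i) - real_of_int (y$i) - c i) = 0"
        by (auto intro!: tent_eq_0)
      then show ?thesis by (simp add: \<psi>_def)
    qed
    have "\<exists>\<delta>>0. \<exists>K. finite K \<and> (\<forall>q. finite (set_pmf q) \<longrightarrow> set_pmf q \<subseteq> unit_cube \<longrightarrow>
           (\<forall>k\<in>K. cmod (measure_pmf.expectation q (expo (x + int_vec k))) < \<delta>) \<longrightarrow>
           cmod (measure_pmf.expectation q (\<lambda>v. f c y v * expo x v)) < \<alpha>)"
    proof (rule small_coefficients_imp_small_expectation[OF _ \<open>0 < \<alpha>\<close>])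
      show "continuous_on unit_cube (f c y)"
        unfolding f_def \<psi>_def by (intro continuous_intros)
    next
      fix u v :: "real^'d"
      assume uv: "u \<in> unit_cube" "v \<in> unit_cube"
        "\<forall>i. cis (2 * pi * u$i) = cis (2 * pi * v$i)"
      have "\<psi> (c i) (real_of_int (y$i)) i (u$i) = \<psi> (c i) (real_of_int (y$i)) i (v$i)" for i
      proof -
        obtain n :: int where n: "v$i = u$i + real_of_int n"
          using cis_2pi_eq_imp_int_diff uv(3) by blast
        have uvi: "0 \<le> u$i" "u$i \<le> 1" "0 \<le> v$i" "v$i \<le> 1"
          using uv(1,2) by (auto simp: unit_cube_def)
        then have "-1 \<le> n" "n \<le> 1" using n by linarith+
        then consider "n = 0" | "n = 1" | "n = -1" by linarith
        then show ?thesis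
        proof cases
          case 2
          then have "u$i = 0" "v$i = 1" using n uvi by auto
          then show ?thesis using \<psi>01[of i] by simp
        next
          case 3
          then have "u$i = 1" "v$i = 0" using n uvi by auto
          then show ?thesis using \<psi>01[of i] by simp
        qed (use n in simp)
      qed
      then show "f c y u = f c y v" by (simp add: f_def)
    qed
    then show ?thesis by (simp add: cy(1) good_def)
  qed
  then obtain \<delta> K where "\<And>j. j \<in> J \<Longrightarrow> good j (\<delta> j) (K j)"
    by metis
  then have \<delta>K: "\<And>j. j \<in> J \<Longrightarrow> 0 < \<delta> j" "\<And>j. j \<in> J \<Longrightarrow> finite (K j)"
    "\<And>j q. j \<in> J \<Longrightarrow> finite (set_pmf q) \<Longrightarrow> set_pmf q \<subseteq> unit_cube \<Longrightarrow>
           (\<forall>k\<in>K j. cmod (measure_pmf.expectation q (expo (x + int_vec k))) < \<delta> j) \<Longrightarrow>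
           cmod (measure_pmf.expectation q (\<lambda>v. f (fst j) (snd j) v * expo x v)) < \<alpha>"
    unfolding good_def by simp_all
  define \<delta>0 where "\<delta>0 = Min (insert 1 (\<delta> ` J))"
  have \<delta>0: "0 < \<delta>0" "\<And>j. j \<in> J \<Longrightarrow> \<delta>0 \<le> \<delta> j"
    using \<delta>K(1) \<open>finite J\<close> unfolding \<delta>0_def by (simp_all add: Min_gr_iff del: Min_insert)
  have "\<exists>k\<in>\<Union>(K ` J). \<delta>0 \<le> cmod (measure_pmf.expectation (digit_law m B p) (expo (x + int_vec k)))"
    if p: "finite (set_pmf p)" "set_pmf p \<subseteq> unit_cube" for p
  proof (rule ccontr)
    assume neg: "\<not> ?thesis"
    let ?q = "digit_law m B p"
    have q: "finite (set_pmf ?q)" "set_pmf ?q \<subseteq> unit_cube"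
      using finite_set_digit_law set_digit_law_subset_unit_cube inD p by blast+
    have intp: "integrable (measure_pmf p) g" for g :: "real^'d \<Rightarrow> real"
      by (rule integrable_measure_pmf_finite[OF p(1)])
    have intq: "integrable (measure_pmf ?q) g" for g :: "real^'d \<Rightarrow> complex"
      by (rule integrable_measure_pmf_finite[OF q(1)])
    have small: "cmod (measure_pmf.expectation ?q (\<lambda>v. f c y v * expo x v)) < \<alpha>" if "(c, y) \<in> J" for c y
      using \<delta>K(3)[OF that q] neg \<delta>0(2)[OF that] that by (force simp: not_le)
    let ?W = "UNIV \<rightarrow>\<^sub>E {0, 1/2, 1::real} :: ('d \<Rightarrow> real) set"
    let ?E = "\<lambda>w. measure_pmf.expectation p (\<lambda>v. \<Prod>i\<in>UNIV. tent (v$i - w i))"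
    have "(\<Sum>w\<in>?W. ?E w) = measure_pmf.expectation p (\<lambda>v. \<Sum>w\<in>?W. \<Prod>i\<in>UNIV. tent (v$i - w i))"
      by (simp add: intp)
    also have "\<dots> = measure_pmf.expectation p (\<lambda>v. 1)"
    proof (rule integral_cong_AE)
      have "(\<Sum>w\<in>?W. \<Prod>i\<in>UNIV. tent (v$i - w i)) = 1" if "v \<in> set_pmf p" for v
      proof -
        have v: "0 \<le> v$i" "v$i \<le> 1" for i
          using that p(2) by (auto simp: unit_cube_def)
        have "(\<Sum>w\<in>?W. \<Prod>i\<in>UNIV. tent (v$i - w i)) = (\<Prod>i\<in>UNIV. \<Sum>w\<in>{0, 1/2, 1}. tent (v$i - w))"
          by (rule prod_sum_PiE[symmetric]) auto
        also have "\<dots> = 1"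
          using tent_partition[OF v] by (intro prod.neutral) simp
        finally show ?thesis .
      qed
      then show "AE v in measure_pmf p. (\<Sum>w\<in>?W. \<Prod>i\<in>UNIV. tent (v$i - w i)) = 1"
        by (simp add: AE_measure_pmf_iff)
    qed auto
    finally have sumE: "(\<Sum>w\<in>?W. ?E w) = 1" by simp
    have cardW: "card ?W = 3 ^ CARD('d)" by (simp add: card_PiE numeral_3_eq_3)
    have "\<exists>w\<in>?W. 1 / 3 ^ CARD('d) \<le> ?E w"
    proof (rule ccontr)
      assume "\<not> ?thesis"
      then have "(\<Sum>w\<in>?W. ?E w) < (\<Sum>w\<in>?W. 1 / 3 ^ CARD('d))"
        by (intro sum_strict_mono finite_PiE) (auto simp: not_le PiE_eq_empty_iff)
      then show False using sumE cardW by simp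
    qed
    then obtain w where w: "w \<in> ?W" "1 / 3 ^ CARD('d) \<le> ?E w" by blast
    \<comment> \<open>The centre 1 is split into the cell offset 1 and the fractional part 0, which
      keeps \<open>c i\<close> in the range where the bumps are periodic.\<close>
    define c where "c i = (if w i = 1 then 0 else w i)" for i
    define s :: "int^'d" where "s = (\<chi> i. if w i = 1 then 1 else 0)"
    have c: "c i \<in> {0, 1/2}" for i
      using w(1) by (auto simp: c_def PiE_iff)
    have wcs: "w i = real_of_int (s$i) + c i" for i
      by (simp add: c_def s_def)
    define P where "P z = measure_pmf.expectation p (\<lambda>v. \<Prod>i\<in>UNIV. tent (v$i - real_of_int (z$i) - c i))"
      for z :: "int^'d"
    define Q where "Q z = measure_pmf.expectation ?q (\<lambda>v. \<Prod>i\<in>UNIV. tent (real (m i) * v$i - real_of_int (z$i) - c i))"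
      for z :: "int^'d"
    show False
    proof (rule digit_translates_not_cancelling[where P = P and Q = Q and \<theta> = \<theta> and s = s and \<alpha> = "1 / 3 ^ CARD('d)",
          OF inD in_D_finite[OF inD] big])
      fix z show "0 \<le> P z"
        unfolding P_def by (intro Bochner_Integration.integral_nonneg prod_nonneg) (simp add: tent_nonneg)
    next
      fix z :: "int^'d" and i assume "P z \<noteq> 0"
      show "z$i \<in> {0, 1}"
      proof (rule ccontr)
        assume z: "z$i \<notin> {0, 1}"
        have "P z = measure_pmf.expectation p (\<lambda>_. 0)"
          unfolding P_def
        proof (rule integral_cong_AE)
          have "(\<Prod>i\<in>UNIV. tent (v$i - real_of_int (z$i) - c i)) = 0" if "v \<in> set_pmf p" for v
          proof -
            have v: "0 \<le> v$i" "v$i \<le> 1"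
              using that p(2) by (auto simp: unit_cube_def)
            have "z$i \<le> -1 \<or> 2 \<le> z$i" using z by auto
            then have "real_of_int (z$i) \<le> -1 \<or> 2 \<le> real_of_int (z$i)" by linarith
            then have "tent (v$i - real_of_int (z$i) - c i) = 0"
              using v c[of i] by (intro tent_eq_0) auto
            then show ?thesis by (meson UNIV_I finite_code prod_zero)
          qed
          then show "AE v in measure_pmf p. (\<Prod>i\<in>UNIV. tent (v$i - real_of_int (z$i) - c i)) = 0"
            by (simp add: AE_measure_pmf_iff)
        qed auto
        then show False using \<open>P z \<noteq> 0\<close> by simp
      qed
    next
      show "1 / 3 ^ CARD('d) \<le> P s"
        using w(2) by (simp add: P_def wcs diff_diff_eq)
    next
      fix z :: "int^'d"
      \<comment> \<open>Multiplying by \<open>m\<close> turns the point of the digit layer into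
        \<open>b + v\<close>, so the bump on cell \<open>z\<close> pulls back to the bump on cell
        \<open>z - b\<close> for \<open>p\<close>.\<close>
      have "(\<Prod>i\<in>UNIV. tent (real (m i) * ((\<chi> i. (real_of_int (b$i) + v$i) / real (m i)) $ i) - real_of_int (z$i) - c i))
          = (\<Prod>i\<in>UNIV. tent (v$i - real_of_int ((z - b)$i) - c i))" for b v
        by (intro prod.cong refl arg_cong[of _ _ tent]) (simp add: m0)
      then show "Q z = (\<Sum>b\<in>B. P (z - b)) / real (card B)"
        unfolding Q_def P_def by (subst expectation_digit_law[OF inD p(1)]) (simp add: divide_inverse mult.commute)
    next
      fix e show "cmod (\<theta> e) = 1" by (simp add: \<theta>_def prod_norm[symmetric])
    next
      fix y :: "int^'d" assume y: "\<forall>i. 0 \<le> y$i \<and> y$i < int (m i)"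
      have "f c y v * expo x v = (\<Sum>e\<in>UNIV \<rightarrow>\<^sub>E {0, 1}. \<theta> e * complex_of_real
          (\<Prod>i\<in>UNIV. tent (real (m i) * v$i - real_of_int ((\<chi> i. y$i + int (m i) * e i)$i) - c i)))" for v
      proof -
        have ex: "expo x v = (\<Prod>i\<in>UNIV. cis (2 * pi * x$i * v$i))"
          by (simp add: expo_def inner_vec_def sum_distrib_left cis_sum mult.assoc)
        have "f c y v = (\<Sum>e\<in>UNIV \<rightarrow>\<^sub>E {0, 1::int}. \<Prod>i\<in>UNIV.
            complex_of_real (tent (real (m i) * (v$i - e i) - real_of_int (y$i) - c i)) * cis (- (2 * pi * x$i * (v$i - e i))))"
          unfolding f_def \<psi>_def by (rule prod_sum_PiE) auto
        then have "f c y v * expo x v = (\<Sum>e\<in>UNIV \<rightarrow>\<^sub>E {0, 1::int}. (\<Prod>i\<in>UNIV.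
            complex_of_real (tent (real (m i) * (v$i - e i) - real_of_int (y$i) - c i)) * cis (- (2 * pi * x$i * (v$i - e i)))
              * cis (2 * pi * x$i * v$i)))"
          by (simp add: ex sum_distrib_right prod.distrib)
        also have "\<dots> = (\<Sum>e\<in>UNIV \<rightarrow>\<^sub>E {0, 1}. \<theta> e * complex_of_real
          (\<Prod>i\<in>UNIV. tent (real (m i) * v$i - real_of_int ((\<chi> i. y$i + int (m i) * e i)$i) - c i)))"
          unfolding \<theta>_def of_real_prod prod.distrib[symmetric]
          by (intro sum.cong prod.cong refl) (simp add: mult.assoc cis_mult algebra_simps)
        finally show ?thesis .
      qed
      then have "measure_pmf.expectation ?q (\<lambda>v. f c y v * expo x v) =
          (\<Sum>e\<in>UNIV \<rightarrow>\<^sub>E {0, 1}. \<theta> e * complex_of_real (Q (\<chi> i. y$i + int (m i) * e i)))"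
        unfolding Q_def by (simp add: intq del: of_real_prod)
      moreover have "(c, y) \<in> J"
        using c y by (auto simp: J_def PiE_iff)
      ultimately show "cmod (\<Sum>e\<in>UNIV \<rightarrow>\<^sub>E {0, 1}. \<theta> e * complex_of_real (Q (\<chi> i. y$i + int (m i) * e i)))
          < 1 / 3 ^ CARD('d) / real (card B)"
        using small unfolding \<alpha>_def by metis
    qed auto
  qed
  then show ?thesis
    using \<delta>0(1) \<delta>K(2) \<open>finite J\<close> by (intro exI[of _ \<delta>0] exI[of _ "\<Union>(K ` J)"] conjI) auto
qed

text \<open>Integer translation brings \<open>x\<close> into the cube at the price of shifting
  \<open>K\<close>, and there a finite cover suffices: on a ball of radius \<delta> x / (2 C) the
  Lipschitz bound loses at most half of \<delta> x. The set \<open>K\<close> may still depend on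
  \<open>x\<close>, but not on \<open>p\<close>; this finiteness is what the later pigeonhole over
  truncations needs.\<close>

lemma digit_law_coefficient_bound:
  fixes m :: "'d::finite \<Rightarrow> nat"
  assumes inD: "in_D m B" and big: "\<And>i. CARD('d) + 1 \<le> m i"
  shows "\<exists>\<epsilon>>0. \<forall>x :: real^'d. \<exists>K. finite K \<and>
           (\<forall>p. finite (set_pmf p) \<longrightarrow> set_pmf p \<subseteq> unit_cube \<longrightarrow>
             (\<exists>k\<in>K. \<epsilon> \<le> cmod (measure_pmf.expectation (digit_law m B p) (expo (x + int_vec k)))))"
proof -
  define C where "C = 2 * pi * real CARD('d)"
  have "0 < C" by (simp add: C_def)
  obtain \<delta> K where \<delta>K: "\<And>x. 0 < \<delta> x" "\<And>x. finite (K x)"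
    "\<And>x p. finite (set_pmf p) \<Longrightarrow> set_pmf p \<subseteq> unit_cube \<Longrightarrow>
       \<exists>k\<in>K x. \<delta> x \<le> cmod (measure_pmf.expectation (digit_law m B p) (expo (x + int_vec k)))"
    using digit_law_coefficient_bound_pointwise[OF inD big] by metis
  have "unit_cube \<subseteq> (\<Union>x\<in>unit_cube. ball x (\<delta> x / (2 * C)))"
  proof
    fix x :: "real^'d" assume "x \<in> unit_cube"
    moreover have "x \<in> ball x (\<delta> x / (2 * C))" using \<delta>K(1)[of x] \<open>0 < C\<close> by simp
    ultimately show "x \<in> (\<Union>x\<in>unit_cube. ball x (\<delta> x / (2 * C)))" by blast
  qed
  then obtain X where X: "X \<subseteq> unit_cube" "finite X" "unit_cube \<subseteq> (\<Union>x\<in>X. ball x (\<delta> x / (2 * C)))"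
    using compactE_image[OF compact_unit_cube, of unit_cube "\<lambda>x. ball x (\<delta> x / (2 * C))"] by (metis open_ball)
  define \<epsilon> where "\<epsilon> = Min (insert 1 ((\<lambda>x. \<delta> x / 2) ` X))"
  have \<epsilon>_pos: "0 < \<epsilon>"
    using X(2) \<delta>K(1) unfolding \<epsilon>_def by (simp add: Min_gr_iff del: Min_insert)
  have \<epsilon>_le: "\<epsilon> \<le> \<delta> x / 2" if "x \<in> X" for x
    unfolding \<epsilon>_def using X(2) that by (intro Min_le) auto
  have "\<exists>K'. finite K' \<and> (\<forall>p. finite (set_pmf p) \<longrightarrow> set_pmf p \<subseteq> unit_cube \<longrightarrow>
             (\<exists>k\<in>K'. \<epsilon> \<le> cmod (measure_pmf.expectation (digit_law m B p) (expo (x + int_vec k)))))"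
    for x :: "real^'d"
  proof -
    define n :: "int^'d" where "n = (\<chi> i. \<lfloor>x$i\<rfloor>)"
    have "x - int_vec n \<in> unit_cube"
    proof -
      have "0 \<le> x$i - real_of_int \<lfloor>x$i\<rfloor> \<and> x$i - real_of_int \<lfloor>x$i\<rfloor> \<le> 1" for i by linarith
      then show ?thesis by (simp add: unit_cube_def n_def)
    qed
    then obtain x' where x': "x' \<in> X" "dist x' (x - int_vec n) < \<delta> x' / (2 * C)"
      using X(3) by auto
    have "\<exists>k\<in>(\<lambda>k. k - n) ` K x'. \<epsilon> \<le> cmod (measure_pmf.expectation (digit_law m B p) (expo (x + int_vec k)))"
      if p: "finite (set_pmf p)" "set_pmf p \<subseteq> unit_cube" for p
    proof -
      let ?E = "\<lambda>\<xi>. measure_pmf.expectation (digit_law m B p) (expo \<xi>)"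
      obtain k where k: "k \<in> K x'" "\<delta> x' \<le> cmod (?E (x' + int_vec k))"
        using \<delta>K(3)[OF p] by blast
      have "cmod (?E (x' + int_vec k) - ?E (x + int_vec (k - n)))
          \<le> C * norm ((x' + int_vec k) - (x + int_vec (k - n)))"
        unfolding C_def using finite_set_digit_law set_digit_law_subset_unit_cube inD p
        by (intro cmod_expectation_expo_diff_le) blast+
      also have "(x' + int_vec k) - (x + int_vec (k - n)) = x' - (x - int_vec n)"
        by (simp add: int_vec_diff)
      also have "C * norm (x' - (x - int_vec n)) \<le> C * (\<delta> x' / (2 * C))"
        using x'(2) \<open>0 < C\<close> by (intro mult_left_mono) (auto simp: dist_norm)
      also have "\<dots> = \<delta> x' / 2" using \<open>0 < C\<close> by simp
      finally have "\<delta> x' / 2 \<le> cmod (?E (x + int_vec (k - n)))"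
        using k(2) norm_triangle_ineq2[of "?E (x' + int_vec k)" "?E (x + int_vec (k - n))"] by linarith
      then show ?thesis using k(1) \<epsilon>_le[OF x'(1)] by force
    qed
    then show ?thesis using \<delta>K(2) by (intro exI[of _ "(\<lambda>k. k - n) ` K x'"]) auto
  qed
  then show ?thesis using \<epsilon>_pos by blast
qed

section \<open>Masks and spectra of finite blocks\<close>

definition vdiv :: "real^'d::finite \<Rightarrow> ('d \<Rightarrow> nat) \<Rightarrow> real^'d" where
  "vdiv \<xi> m = (\<chi> i. \<xi>$i / real (m i))"

lemma vdiv_nth [simp]: "vdiv \<xi> m $ i = \<xi>$i / real (m i)"
  by (simp add: vdiv_def)

lemma vdiv_0 [simp]: "vdiv 0 m = 0"
  by (simp add: vec_eq_iff)

lemma vdiv_add: "vdiv (\<xi> + \<eta>) m = vdiv \<xi> m + vdiv \<eta> m"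
  by (simp add: vec_eq_iff add_divide_distrib)

lemma vdiv_vdiv: "vdiv (vdiv \<xi> m) m' = vdiv \<xi> (\<lambda>i. m i * m' i)"
  by (simp add: vec_eq_iff)

lemma norm_vdiv_le:
  assumes "\<And>i. 2 ^ n \<le> m i"
  shows "norm (vdiv \<xi> m) \<le> norm \<xi> / 2 ^ n"
proof -
  have "norm (vdiv \<xi> m $ i) \<le> norm ((\<xi> /\<^sub>R 2 ^ n) $ i)" for i
  proof -
    have "real (2 ^ n) \<le> real (m i)" using assms by (simp only: of_nat_le_iff)
    then have "(2::real) ^ n \<le> real (m i)" "0 < real (m i)"
      by (simp_all add: less_le_trans[of 0 "2 ^ n" "m i"])
    then have "\<bar>\<xi>$i\<bar> / real (m i) \<le> \<bar>\<xi>$i\<bar> / 2 ^ n"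
      by (intro divide_left_mono mult_pos_pos) auto
    then show ?thesis by (simp add: abs_mult divide_inverse mult.commute)
  qed
  then have "norm (vdiv \<xi> m) \<le> norm (\<xi> /\<^sub>R 2 ^ n)"
    by (rule norm_le_componentwise_cart)
  then show ?thesis by (simp add: divide_inverse mult.commute)
qed

text \<open>The Fourier transform of the uniform measure on the digits after division by
  \<open>m\<close>.\<close>

definition mask :: "('d::finite \<Rightarrow> nat) \<Rightarrow> (int^'d) set \<Rightarrow> real^'d \<Rightarrow> complex" where
  "mask m B \<xi> = (\<Sum>b\<in>B. expo \<xi> (diag_inv_apply m b)) / of_nat (card B)"

text \<open>When \<open>f\<close> is the transform of a finitely supported probability measure, this
  is Parseval's identity for all exponentials, so it says that \<open>X\<close> is a spectrum. In
  this form the property multiplies along blocks.\<close>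

definition unit_square_sum :: "(real^'d::finite \<Rightarrow> complex) \<Rightarrow> (int^'d) set \<Rightarrow> bool" where
  "unit_square_sum f X \<longleftrightarrow> (\<forall>\<xi>. (\<Sum>x\<in>X. (cmod (f (\<xi> + int_vec x)))\<^sup>2) = 1)"

lemma expo_periodic_diag:
  assumes "\<And>i. int (m i) dvd k$i" "\<And>i. m i \<noteq> 0"
  shows "expo (int_vec k) (diag_inv_apply m b) = 1"
proof -
  obtain k' where k': "\<And>i. k$i = int (m i) * k' i"
    using assms(1) unfolding dvd_def by metis
  have "int_vec k \<bullet> diag_inv_apply m b = int_vec (\<chi> i. k' i) \<bullet> int_vec b"
    unfolding inner_vec_def
  proof (intro sum.cong refl)
    fix i show "int_vec k $ i \<bullet> diag_inv_apply m b $ i = int_vec (\<chi> i. k' i) $ i \<bullet> int_vec b $ i"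
      using assms(2)[of i] by (simp add: k' diag_inv_apply_def)
  qed
  then show ?thesis
    using expo_int_vec_int_vec[of "\<chi> i. k' i" b] by (simp add: expo_def)
qed

lemma mask_periodic:
  assumes "\<And>i. int (m i) dvd k$i" "\<And>i. m i \<noteq> 0"
  shows "mask m B (\<xi> + int_vec k) = mask m B \<xi>"
  unfolding mask_def by (simp add: expo_add expo_periodic_diag[OF assms])

text \<open>Expanding the square leaves sums over \<open>L\<close> that vanish off the diagonal by
  unitarity. Translating \<open>L\<close> only moves \<xi>, and so 0 may be assumed to belong to it;
  this is what later makes the frequency sets nested.\<close>

lemma admissible_unit_square_sum:
  fixes m :: "'d::finite \<Rightarrow> nat"
  assumes "in_D m B" "admissible m B"
  shows "\<exists>L. finite L \<and> 0 \<in> L \<and> unit_square_sum (mask m B) L"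
proof -
  let ?N = "real (card B)"
  have N: "0 < ?N" using in_D_card_pos[OF assms(1)] by simp
  have fin: "finite B" by (rule in_D_finite[OF assms(1)])
  obtain L where L: "finite L" "card L = card B"
    "\<And>b b'. b \<in> B \<Longrightarrow> b' \<in> B \<Longrightarrow> (\<Sum>l\<in>L. adm_entry m B b l * cnj (adm_entry m B b' l)) = (if b = b' then 1 else 0)"
    using assms(2) unfolding admissible_def by blast
  define u where "u l b = expo (int_vec l) (diag_inv_apply m b)" for l b
  have adm: "adm_entry m B b l = complex_of_real (1 / sqrt ?N) * cnj (u l b)" for b l
    by (simp add: adm_entry_def u_def expo_def cis_cnj inner_commute)
  have orth: "(\<Sum>l\<in>L. u l b * cnj (u l b')) = (if b = b' then of_nat (card B) else 0)"
    if "b \<in> B" "b' \<in> B" for b b'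
  proof -
    have s: "complex_of_real (1 / sqrt ?N) * complex_of_real (1 / sqrt ?N) = 1 / of_nat (card B)"
      using N by (simp flip: of_real_mult add: real_sqrt_mult_self)
    have "(\<Sum>l\<in>L. adm_entry m B b' l * cnj (adm_entry m B b l))
        = (complex_of_real (1 / sqrt ?N) * complex_of_real (1 / sqrt ?N)) * (\<Sum>l\<in>L. u l b * cnj (u l b'))"
      unfolding adm sum_distrib_left by (intro sum.cong refl) simp
    then have "(\<Sum>l\<in>L. u l b * cnj (u l b')) / of_nat (card B) = (if b' = b then 1 else 0)"
      using L(3)[OF that(2,1)] unfolding s by simp
    then show ?thesis using N by (auto simp: field_simps)
  qed
  have sum1: "(\<Sum>l\<in>L. (cmod (mask m B (\<xi> + int_vec l)))\<^sup>2) = 1" for \<xi>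
  proof -
    define a where "a b = expo \<xi> (diag_inv_apply m b)" for b
    have a: "a b * cnj (a b) = 1" for b
      by (simp add: a_def complex_norm_square[symmetric])
    have mk: "mask m B (\<xi> + int_vec l) = (\<Sum>b\<in>B. a b * u l b) / of_nat (card B)" for l
      by (simp add: mask_def a_def u_def expo_add)
    have "complex_of_real (\<Sum>l\<in>L. (cmod (mask m B (\<xi> + int_vec l)))\<^sup>2)
        = (\<Sum>l\<in>L. (\<Sum>b\<in>B. a b * u l b) * (\<Sum>b'\<in>B. cnj (a b') * cnj (u l b')) / (of_nat (card B))\<^sup>2)"
      unfolding of_real_sum complex_norm_square mk
      by (intro sum.cong refl) (simp add: power2_eq_square)
    also have "\<dots> = (\<Sum>l\<in>L. \<Sum>b\<in>B. \<Sum>b'\<in>B. a b * cnj (a b') * (u l b * cnj (u l b'))) / (of_nat (card B))\<^sup>2"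
      by (simp add: sum_divide_distrib sum_product mult_ac)
    also have "(\<Sum>l\<in>L. \<Sum>b\<in>B. \<Sum>b'\<in>B. a b * cnj (a b') * (u l b * cnj (u l b')))
        = (\<Sum>b\<in>B. \<Sum>b'\<in>B. a b * cnj (a b') * (\<Sum>l\<in>L. u l b * cnj (u l b')))"
      unfolding sum_distrib_left by (subst sum.swap, rule sum.cong[OF refl], rule sum.swap)
    also have "\<dots> = (\<Sum>b\<in>B. \<Sum>b'\<in>B. if b' = b then of_nat (card B) else 0)"
      by (intro sum.cong refl) (auto simp: orth a)
    also have "\<dots> = (of_nat (card B))\<^sup>2"
      using fin by (simp add: sum.delta power2_eq_square)
    finally have "complex_of_real (\<Sum>l\<in>L. (cmod (mask m B (\<xi> + int_vec l)))\<^sup>2) = 1"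
      using N by simp
    then show ?thesis by (simp only: of_real_eq_1_iff)
  qed
  obtain l0 where l0: "l0 \<in> L"
    using L(1,2) N by (metis card.empty equals0I of_nat_0 less_irrefl)
  have "(\<Sum>x\<in>(\<lambda>l. l - l0) ` L. (cmod (mask m B (\<xi> + int_vec x)))\<^sup>2) = 1" for \<xi>
    using sum1[of "\<xi> - int_vec l0"]
    by (subst sum.reindex) (auto simp: inj_on_def int_vec_diff algebra_simps)
  then show ?thesis
    using L(1) l0 unfolding unit_square_sum_def by (intro exI[of _ "(\<lambda>l. l - l0) ` L"]) auto
qed

text \<open>Two indices with the same point would both contribute \<open>f 0 = 1\<close> when \<xi>
  is minus that point. Injectivity thus follows from the sum identity, with no arithmetic on residue
  classes.\<close>

lemma unit_square_sum_inj_on: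
  fixes x :: "'i \<Rightarrow> int^'d::finite"
  assumes "finite I" "f 0 = 1" "\<And>\<xi>. (\<Sum>i\<in>I. (cmod (f (\<xi> + int_vec (x i))))\<^sup>2) = 1"
  shows "inj_on x I"
proof (rule inj_onI, rule ccontr)
  fix i j assume ij: "i \<in> I" "j \<in> I" "x i = x j" "i \<noteq> j"
  have "(\<Sum>k\<in>{i, j}. (cmod (f (- int_vec (x i) + int_vec (x k))))\<^sup>2)
      \<le> (\<Sum>k\<in>I. (cmod (f (- int_vec (x i) + int_vec (x k))))\<^sup>2)"
    using ij assms(1) by (intro sum_mono2) auto
  moreover have "(\<Sum>k\<in>I. (cmod (f (- int_vec (x i) + int_vec (x k))))\<^sup>2) = 1"
    by (rule assms(3))
  ultimately show False using ij assms(2) by simp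
qed

text \<open>This recursion and the two after it peel off the first layer and advance the starting
  index. A tail starting at the distinguished pair is then literally a digit layer applied to
  another tail.\<close>

primrec scale_prod :: "(nat \<Rightarrow> 'd \<Rightarrow> nat) \<Rightarrow> nat \<Rightarrow> nat \<Rightarrow> 'd \<Rightarrow> nat" where
  "scale_prod ms n 0 = (\<lambda>_. 1)"
| "scale_prod ms n (Suc j) = (\<lambda>i. ms (Suc n) i * scale_prod ms (Suc n) j i)"

primrec block_mask ::
    "(nat \<Rightarrow> 'd::finite \<Rightarrow> nat) \<Rightarrow> (nat \<Rightarrow> (int^'d) set) \<Rightarrow> nat \<Rightarrow> nat \<Rightarrow> real^'d \<Rightarrow> complex" where
  "block_mask ms Bs n 0 = (\<lambda>_. 1)"
| "block_mask ms Bs n (Suc j) =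
     (\<lambda>\<xi>. mask (ms (Suc n)) (Bs (Suc n)) \<xi> * block_mask ms Bs (Suc n) j (vdiv \<xi> (ms (Suc n))))"

primrec block_law ::
    "(nat \<Rightarrow> 'd::finite \<Rightarrow> nat) \<Rightarrow> (nat \<Rightarrow> (int^'d) set) \<Rightarrow> nat \<Rightarrow> nat \<Rightarrow> (real^'d) pmf" where
  "block_law ms Bs n 0 = return_pmf 0"
| "block_law ms Bs n (Suc j) = digit_law (ms (Suc n)) (Bs (Suc n)) (block_law ms Bs (Suc n) j)"

lemma scale_prod_add: "scale_prod ms n (j + k) i = scale_prod ms n j i * scale_prod ms (n + j) k i"
  by (induction j arbitrary: n) auto

lemma block_mask_add:
  "block_mask ms Bs n (j + k) \<xi>
    = block_mask ms Bs n j \<xi> * block_mask ms Bs (n + j) k (vdiv \<xi> (scale_prod ms n j))"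
proof (induction j arbitrary: n \<xi>)
  case 0
  have "vdiv \<xi> (\<lambda>_. 1) = \<xi>" by (simp add: vec_eq_iff)
  then show ?case by simp
qed (simp add: vdiv_vdiv)

lemma infinite_lower_bound_imp_LIMSEQ_ge:
  fixes f :: "nat \<Rightarrow> real"
  assumes "f \<longlonglongrightarrow> l" "infinite {n. a \<le> f n}"
  shows "a \<le> l"
proof (rule ccontr)
  assume "\<not> a \<le> l"
  then have "eventually (\<lambda>n. f n < a) sequentially"
    using assms(1) by (intro order_tendstoD(2)) auto
  then obtain N where N: "\<And>n. N \<le> n \<Longrightarrow> f n < a"
    unfolding eventually_sequentially by blast
  have "{n. a \<le> f n} \<subseteq> {..<N}"
  proof
    fix n assume "n \<in> {n. a \<le> f n}"
    then show "n \<in> {..<N}" using N[of n] by (cases "N \<le> n") auto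
  qed
  then show False using assms(2) finite_subset by blast
qed

locale digit_sequence =
  fixes ms :: "nat \<Rightarrow> 'd::finite \<Rightarrow> nat" and Bs :: "nat \<Rightarrow> (int^'d) set"
  assumes inD: "n \<ge> 1 \<Longrightarrow> in_D (ms n) (Bs n)"
begin

abbreviation "bm \<equiv> block_mask ms Bs"
abbreviation "sp \<equiv> scale_prod ms"

lemma inD_Suc: "in_D (ms (Suc n)) (Bs (Suc n))"
  by (rule inD) simp

lemma ms_ge_2: "2 \<le> ms (Suc n) i"
  using inD_Suc[of n] by (simp add: in_D_def)

lemma scale_prod_ge: "2 ^ j \<le> sp n j i"
  by (induction j arbitrary: n) (auto intro: mult_le_mono ms_ge_2)

lemma scale_prod_pos: "0 < sp n j i"
  using scale_prod_ge[of j n i] by (simp add: less_le_trans[of 0 "2 ^ j"])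

lemma finite_block_law: "finite (set_pmf (block_law ms Bs n j))"
  by (induction j arbitrary: n) (auto intro: finite_set_digit_law inD_Suc)

lemma block_law_cube: "set_pmf (block_law ms Bs n j) \<subseteq> unit_cube"
proof (induction j arbitrary: n)
  case 0
  show ?case by (simp add: unit_cube_def)
next
  case (Suc j)
  then show ?case using set_digit_law_subset_unit_cube[OF inD_Suc] by simp
qed

lemma expectation_block_law: "measure_pmf.expectation (block_law ms Bs n j) (expo \<xi>) = bm n j \<xi>"
proof (induction j arbitrary: n \<xi>)
  case (Suc j)
  let ?m = "ms (Suc n)" and ?B = "Bs (Suc n)"
  have "expo \<xi> (\<chi> i. (real_of_int (b$i) + v$i) / real (?m i)) = expo \<xi> (diag_inv_apply ?m b) * expo (vdiv \<xi> ?m) v" for b v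
  proof -
    have "\<xi> \<bullet> (\<chi> i. (real_of_int (b$i) + v$i) / real (?m i)) = \<xi> \<bullet> diag_inv_apply ?m b + vdiv \<xi> ?m \<bullet> v"
      unfolding inner_vec_def sum.distrib[symmetric]
      by (intro sum.cong refl) (simp add: diag_inv_apply_def add_divide_distrib distrib_left)
    then show ?thesis by (simp add: expo_def cis_mult distrib_left)
  qed
  then show ?case
    by (simp add: expectation_digit_law[OF inD_Suc finite_block_law] Suc.IH mask_def
        sum_distrib_right[symmetric] scaleR_conv_of_real divide_inverse mult_ac)
qed simp

lemma block_mask_zero [simp]: "bm n j 0 = 1"
proof -
  have "expo (0::real^'d) = (\<lambda>_. 1)" by (simp add: fun_eq_iff)
  then show ?thesis by (simp flip: expectation_block_law)
qed

lemma block_mask_lipschitz: "cmod (bm n j \<xi> - bm n j \<eta>) \<le> 2 * pi * real CARD('d) * norm (\<xi> - \<eta>)"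
  using cmod_expectation_expo_diff_le[OF finite_block_law block_law_cube]
  by (simp add: expectation_block_law)

text \<open>The atoms of the block have coordinates that are integer multiples of the reciprocals of
  the accumulated scales.\<close>

lemma block_mask_periodic:
  assumes "\<And>i. int (sp n j i) dvd k$i"
  shows "bm n j (\<xi> + int_vec k) = bm n j \<xi>"
  using assms
proof (induction j arbitrary: n \<xi> k)
  case (Suc j)
  let ?m = "ms (Suc n)"
  have m0: "?m i \<noteq> 0" for i using ms_ge_2[of n i] by linarith
  have d: "int (?m i) * int (sp (Suc n) j i) dvd k$i" for i
    using Suc.prems[of i] by simp
  have dm: "int (?m i) dvd k$i" for i
    using d[of i] by (rule dvd_mult_left)
  define k' :: "int^'d" where "k' = (\<chi> i. k$i div int (?m i))"
  have k': "k$i = int (?m i) * k'$i" for i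
    using dm[of i] by (simp add: k'_def)
  have "int (sp (Suc n) j i) dvd k'$i" for i
    using d[of i] m0[of i] by (simp add: k')
  moreover have "vdiv (\<xi> + int_vec k) ?m = vdiv \<xi> ?m + int_vec k'"
    using m0 by (simp add: vec_eq_iff k' add_divide_distrib)
  ultimately show ?case
    using Suc.IH[of "Suc n" k'] mask_periodic[OF dm m0] by simp
qed simp

text \<open>The \<kappa>-term lies in the period lattice of the whole block of length
  \<open>j + k\<close>. It leaves the block transform alone and translates the frequency seen by the
  tail beyond the block by \<kappa>; this is the free parameter of the construction.\<close>

definition combine :: "nat \<Rightarrow> nat \<Rightarrow> nat \<Rightarrow> (int^'d \<Rightarrow> int^'d \<Rightarrow> int^'d) \<Rightarrow> (int^'d) \<times> (int^'d) \<Rightarrow> int^'d" where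
  "combine n j k \<kappa> = (\<lambda>(x, l). \<chi> i. x$i + int (sp n j i) * l$i + int (sp n (j + k) i) * \<kappa> x l $ i)"

text \<open>Periodicity removes \<kappa> from both factors and \<open>l\<close> from the first, so
  for fixed \<open>x\<close> the inner sum over \<open>l\<close> is 1, and then the outer sum is 1
  as well.\<close>

lemma combine_unit_square_sum:
  assumes X: "finite X" "unit_square_sum (bm n j) X"
    and L: "finite L" "unit_square_sum (bm (n + j) k) L"
  shows "unit_square_sum (bm n (j + k)) (combine n j k \<kappa> ` (X \<times> L))"
proof -
  have factor: "bm n (j + k) (\<xi> + int_vec (combine n j k \<kappa> (x, l)))
      = bm n j (\<xi> + int_vec x) * bm (n + j) k (vdiv (\<xi> + int_vec x) (sp n j) + int_vec l)" for \<xi> x l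
  proof -
    define u :: "int^'d" where "u = (\<chi> i. int (sp n j i) * l$i + int (sp n (j + k) i) * \<kappa> x l $ i)"
    define w :: "int^'d" where "w = (\<chi> i. int (sp (n + j) k i) * \<kappa> x l $ i)"
    have 1: "\<xi> + int_vec (combine n j k \<kappa> (x, l)) = (\<xi> + int_vec x) + int_vec u"
      by (simp add: vec_eq_iff combine_def u_def)
    have 2: "bm n j ((\<xi> + int_vec x) + int_vec u) = bm n j (\<xi> + int_vec x)"
      by (rule block_mask_periodic) (simp add: u_def scale_prod_add)
    have 3: "vdiv ((\<xi> + int_vec x) + int_vec u) (sp n j) = (vdiv (\<xi> + int_vec x) (sp n j) + int_vec l) + int_vec w"
      unfolding vec_eq_iff
    proof
      fix i
      have "real (sp n j i) \<noteq> 0" using scale_prod_pos[of n j i] by simp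
      then show "vdiv ((\<xi> + int_vec x) + int_vec u) (sp n j) $ i = ((vdiv (\<xi> + int_vec x) (sp n j) + int_vec l) + int_vec w) $ i"
        by (simp add: u_def w_def scale_prod_add field_simps)
    qed
    have 4: "bm (n + j) k ((vdiv (\<xi> + int_vec x) (sp n j) + int_vec l) + int_vec w)
        = bm (n + j) k (vdiv (\<xi> + int_vec x) (sp n j) + int_vec l)"
      by (rule block_mask_periodic) (simp add: w_def)
    show ?thesis unfolding block_mask_add 1 2 3 4 by simp
  qed
  have sum1: "(\<Sum>p\<in>X \<times> L. (cmod (bm n (j + k) (\<xi> + int_vec (combine n j k \<kappa> p))))\<^sup>2) = 1" for \<xi>
  proof -
    have "(\<Sum>p\<in>X \<times> L. (cmod (bm n (j + k) (\<xi> + int_vec (combine n j k \<kappa> p))))\<^sup>2)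
        = (\<Sum>x\<in>X. \<Sum>l\<in>L. (cmod (bm n (j + k) (\<xi> + int_vec (combine n j k \<kappa> (x, l)))))\<^sup>2)"
      by (simp add: sum.cartesian_product split_def)
    also have "\<dots> = (\<Sum>x\<in>X. (cmod (bm n j (\<xi> + int_vec x)))\<^sup>2 *
        (\<Sum>l\<in>L. (cmod (bm (n + j) k (vdiv (\<xi> + int_vec x) (sp n j) + int_vec l)))\<^sup>2))"
      by (simp add: factor norm_mult power_mult_distrib sum_distrib_left)
    also have "\<dots> = 1"
      using X(2) L(2) by (simp add: unit_square_sum_def)
    finally show ?thesis .
  qed
  have "inj_on (combine n j k \<kappa>) (X \<times> L)"
    using X(1) L(1) by (intro unit_square_sum_inj_on[OF _ block_mask_zero sum1]) simp
  then show ?thesis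
    using sum1 unfolding unit_square_sum_def by (simp add: sum.reindex)
qed

lemma block_spectrum_exists:
  assumes adm: "\<And>n. n \<ge> 1 \<Longrightarrow> admissible (ms n) (Bs n)"
  shows "\<exists>L. finite L \<and> 0 \<in> L \<and> unit_square_sum (bm n j) L"
proof (induction j arbitrary: n)
  case 0
  show ?case by (intro exI[of _ "{0}"]) (simp add: unit_square_sum_def)
next
  case (Suc j)
  obtain X where X: "finite X" "0 \<in> X" "unit_square_sum (mask (ms (Suc n)) (Bs (Suc n))) X"
    using admissible_unit_square_sum[OF inD_Suc adm] by force
  then have X': "unit_square_sum (bm n 1) X" by simp
  obtain L where L: "finite L" "0 \<in> L" "unit_square_sum (bm (n + 1) j) L"
    using Suc.IH[of "n + 1"] by blast
  have "unit_square_sum (bm n (1 + j)) (combine n 1 j (\<lambda>_ _. 0) ` (X \<times> L))"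
    by (rule combine_unit_square_sum[OF X(1) X' L(1,3)])
  moreover have "0 = combine n 1 j (\<lambda>_ _. 0) (0, 0)"
    by (simp add: combine_def vec_eq_iff)
  then have "0 \<in> combine n 1 j (\<lambda>_ _. 0) ` (X \<times> L)"
    using X(2) L(2) by blast
  ultimately show ?case using X(1) L(1) by (metis finite_cartesian_product finite_imageI plus_1_eq_Suc)
qed

text \<open>The bound is required for infinitely many truncations of the tail, so no limit measure
  of the tail has to be constructed. It is enough for the final passage to the limit, since there
  the transforms of the full partial convolutions converge.\<close>

definition good :: "real \<Rightarrow> nat \<Rightarrow> (int^'d) set \<Rightarrow> bool" where
  "good \<epsilon> n X \<longleftrightarrow> finite X \<and> 0 \<in> X \<and> unit_square_sum (bm 0 n) X \<and>
     (\<forall>x\<in>X. infinite {N. \<epsilon> \<le> cmod (bm n N (vdiv (int_vec x) (sp 0 n)))})"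

lemma good_step:
  assumes adm: "\<And>n. n \<ge> 1 \<Longrightarrow> admissible (ms n) (Bs n)"
    and inf: "infinite {n. n \<ge> 1 \<and> ms n = m \<and> Bs n = B}"
    and \<epsilon>: "\<epsilon> \<le> 1/2"
    and pos: "\<And>x. \<exists>K. finite K \<and> (\<forall>p. finite (set_pmf p) \<longrightarrow> set_pmf p \<subseteq> unit_cube \<longrightarrow>
             (\<exists>k\<in>K. \<epsilon> \<le> cmod (measure_pmf.expectation (digit_law m B p) (expo (x + int_vec k)))))"
    and X: "good \<epsilon> n X"
  shows "\<exists>n' X'. n < n' \<and> X \<subseteq> X' \<and> good \<epsilon> n' X'"
proof -
  define C where "C = 2 * pi * real CARD('d)"
  have "0 < C" by (simp add: C_def)
  have finX: "finite X" "0 \<in> X" and X1: "unit_square_sum (bm 0 n) X"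
    using X by (auto simp: good_def)
  define M where "M = Max (insert 0 (norm ` int_vec ` X))"
  have M: "norm (int_vec x) \<le> M" if "x \<in> X" for x
    unfolding M_def using finX(1) that by (intro Max_ge) auto
  \<comment> \<open>After division by at least \<open>2 ^ k0\<close> every old frequency is so close
    to 0 that each tail transform there is within 1/2 of its value 1 at 0.\<close>
  obtain k0 where k0: "2 * C * M < 2 ^ k0"
    using real_arch_pow[of 2 "2 * C * M"] by auto
  obtain n1 where n1: "n1 > Suc (n + k0)" "ms n1 = m" "Bs n1 = B"
    using inf unfolding infinite_nat_iff_unbounded by (metis (mono_tags, lifting) mem_Collect_eq)
  \<comment> \<open>Stopping just before an occurrence of the pair makes it the first layer of the
    tail after stage \<open>n'\<close>.\<close>
  define n' where "n' = n1 - 1"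
  define j where "j = n' - n"
  have n': "n1 = Suc n'" "n' = n + j" "n < n'" "k0 \<le> n'"
    using n1(1) by (auto simp: n'_def j_def)
  obtain L where L: "finite L" "0 \<in> L" "unit_square_sum (bm n j) L"
    using block_spectrum_exists[OF adm] by blast
  have near: "1/2 \<le> cmod (bm n' N (vdiv (int_vec x) (sp 0 n')))" if "x \<in> X" for x N
  proof -
    have "norm (vdiv (int_vec x) (sp 0 n')) \<le> norm (int_vec x) / 2 ^ n'"
      by (rule norm_vdiv_le) (rule scale_prod_ge)
    also have "\<dots> \<le> norm (int_vec x) / 2 ^ k0"
      using n'(4) by (intro divide_left_mono power_increasing) auto
    also have "\<dots> \<le> M / 2 ^ k0"
      using M[OF that] by (intro divide_right_mono) auto
    finally have "C * norm (vdiv (int_vec x) (sp 0 n') - 0) \<le> C * (M / 2 ^ k0)"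
      using \<open>0 < C\<close> by (intro mult_left_mono) auto
    also have "\<dots> \<le> 1/2" using k0 by (simp add: field_simps)
    finally have "cmod (bm n' N (vdiv (int_vec x) (sp 0 n')) - 1) \<le> 1/2"
      using block_mask_lipschitz[of n' N "vdiv (int_vec x) (sp 0 n')" 0] by (simp add: C_def)
    then show ?thesis
      using norm_triangle_ineq2[of 1 "1 - bm n' N (vdiv (int_vec x) (sp 0 n'))"]
      by (simp add: norm_minus_commute)
  qed
  \<comment> \<open>Each truncation of positive length is served by some element of the same finite
    set \<open>K\<close>, so one element serves infinitely many.\<close>
  have "\<exists>\<kappa>. infinite {N. \<epsilon> \<le> cmod (bm n' N (\<zeta> + int_vec \<kappa>))}" for \<zeta>
  proof -
    obtain K where K: "finite K" "\<And>p. finite (set_pmf p) \<Longrightarrow> set_pmf p \<subseteq> unit_cube \<Longrightarrow>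
             (\<exists>k\<in>K. \<epsilon> \<le> cmod (measure_pmf.expectation (digit_law m B p) (expo (\<zeta> + int_vec k))))"
      using pos[of \<zeta>] by blast
    have ex: "\<exists>k\<in>K. \<epsilon> \<le> cmod (bm n' (Suc N) (\<zeta> + int_vec k))" for N
    proof -
      have "digit_law m B (block_law ms Bs (Suc n') N) = block_law ms Bs n' (Suc N)"
        using n1 n'(1) by simp
      then show ?thesis
        using K(2)[OF finite_block_law block_law_cube] expectation_block_law by metis
    qed
    have "infinite (\<Union>k\<in>K. {N. \<epsilon> \<le> cmod (bm n' N (\<zeta> + int_vec k))})"
    proof -
      have "range Suc \<subseteq> (\<Union>k\<in>K. {N. \<epsilon> \<le> cmod (bm n' N (\<zeta> + int_vec k))})"
        using ex by blast
      moreover have "infinite (range Suc)"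
        by (rule range_inj_infinite) simp
      ultimately show ?thesis using infinite_super by blast
    qed
    then show ?thesis using K(1) by blast
  qed
  then obtain \<kappa>0 where \<kappa>0: "\<And>\<zeta>. infinite {N. \<epsilon> \<le> cmod (bm n' N (\<zeta> + int_vec (\<kappa>0 \<zeta>)))}"
    by metis
  define \<zeta> where "\<zeta> x l = vdiv (int_vec (\<chi> i. x$i + int (sp 0 n i) * l$i)) (sp 0 n')" for x l :: "int^'d"
  \<comment> \<open>Frequencies with \<open>l = 0\<close> are the old ones. They must stay where
    they are for \<open>X\<close> to remain a subset, and by \<open>near\<close> they need no
    correction.\<close>
  define \<kappa> where "\<kappa> x l = (if l = 0 then 0 else \<kappa>0 (\<zeta> x l))" for x l
  define X' where "X' = combine 0 n j \<kappa> ` (X \<times> L)"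
  have sp': "sp 0 (n + j) = sp 0 n'" using n' by simp
  have "X \<subseteq> X'"
  proof
    fix x assume "x \<in> X"
    moreover have "x = combine 0 n j \<kappa> (x, 0)"
      by (simp add: combine_def \<kappa>_def vec_eq_iff)
    ultimately show "x \<in> X'" unfolding X'_def using L(2) by blast
  qed
  moreover have "good \<epsilon> n' X'"
    unfolding good_def
  proof (intro conjI ballI)
    show "finite X'" using finX(1) L(1) by (simp add: X'_def)
    show "0 \<in> X'" using \<open>X \<subseteq> X'\<close> finX(2) by blast
    show "unit_square_sum (bm 0 n') X'"
      unfolding X'_def n'(2) by (rule combine_unit_square_sum) (use finX X1 L in auto)
  next
    fix z assume "z \<in> X'"
    then obtain x l where xl: "x \<in> X" "l \<in> L" "z = combine 0 n j \<kappa> (x, l)"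
      by (auto simp: X'_def)
    have zeq: "vdiv (int_vec z) (sp 0 n') = \<zeta> x l + int_vec (\<kappa> x l)"
      unfolding vec_eq_iff
    proof
      fix i
      have "real (sp 0 n' i) \<noteq> 0" using scale_prod_pos[of 0 n' i] by simp
      then show "vdiv (int_vec z) (sp 0 n') $ i = (\<zeta> x l + int_vec (\<kappa> x l)) $ i"
        by (simp add: xl(3) combine_def \<zeta>_def sp' add_divide_distrib)
    qed
    show "infinite {N. \<epsilon> \<le> cmod (bm n' N (vdiv (int_vec z) (sp 0 n')))}"
    proof (cases "l = 0")
      case True
      then have "\<zeta> x l + int_vec (\<kappa> x l) = vdiv (int_vec x) (sp 0 n')"
        by (simp add: \<zeta>_def \<kappa>_def)
      then have "{N. \<epsilon> \<le> cmod (bm n' N (vdiv (int_vec z) (sp 0 n')))} = UNIV"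
        using order_trans[OF \<epsilon> near[OF xl(1)]] unfolding zeq by simp
      then show ?thesis by simp
    next
      case False
      then show ?thesis using \<kappa>0 by (simp add: zeq \<kappa>_def)
    qed
  qed
  ultimately show ?thesis using n'(3) by blast
qed

lemma good_sequence_exists:
  assumes adm: "\<And>n. n \<ge> 1 \<Longrightarrow> admissible (ms n) (Bs n)"
    and inf: "infinite {n. n \<ge> 1 \<and> ms n = m \<and> Bs n = B}"
    and big: "\<And>i. m i \<ge> CARD('d) + 1"
  shows "\<exists>\<epsilon> ns X. 0 < \<epsilon> \<and> strict_mono (ns :: nat \<Rightarrow> nat) \<and> (\<forall>t. X t \<subseteq> X (Suc t) \<and> good \<epsilon> (ns t) (X t))"
proof -
  obtain n0 where "n0 \<ge> 1" "ms n0 = m" "Bs n0 = B"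
    using inf by (metis (mono_tags, lifting) empty_Collect_eq infinite_imp_nonempty)
  then have "in_D m B" using inD by blast
  then obtain \<epsilon>0 where \<epsilon>0: "0 < \<epsilon>0" "\<And>x :: real^'d. \<exists>K. finite K \<and>
           (\<forall>p. finite (set_pmf p) \<longrightarrow> set_pmf p \<subseteq> unit_cube \<longrightarrow>
             (\<exists>k\<in>K. \<epsilon>0 \<le> cmod (measure_pmf.expectation (digit_law m B p) (expo (x + int_vec k)))))"
    using digit_law_coefficient_bound[of m B] big by blast
  \<comment> \<open>\<epsilon>0 is the bound for the corrected new frequencies, and 1/2 the bound at
    which the old ones are carried along.\<close>
  define \<epsilon> where "\<epsilon> = min \<epsilon>0 (1/2)"
  have \<epsilon>: "0 < \<epsilon>" "\<epsilon> \<le> 1/2" "\<epsilon> \<le> \<epsilon>0" using \<epsilon>0(1) by (auto simp: \<epsilon>_def)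
  have pos: "\<exists>K. finite K \<and> (\<forall>p. finite (set_pmf p) \<longrightarrow> set_pmf p \<subseteq> unit_cube \<longrightarrow>
             (\<exists>k\<in>K. \<epsilon> \<le> cmod (measure_pmf.expectation (digit_law m B p) (expo (x + int_vec k)))))"
    for x :: "real^'d"
    using \<epsilon>0(2)[of x] order_trans[OF \<epsilon>(3)] by meson
  have "\<exists>f. \<forall>t. good \<epsilon> (fst (f t)) (snd (f t)) \<and>
      (fst (f t) < fst (f (Suc t)) \<and> snd (f t) \<subseteq> snd (f (Suc t)))"
  proof (rule dependent_nat_choice[where P = "\<lambda>_ z. good \<epsilon> (fst z) (snd z)"
        and Q = "\<lambda>_ z z'. fst z < fst z' \<and> snd z \<subseteq> snd z'"])
    have "{N. \<epsilon> \<le> cmod (bm 0 N (vdiv (int_vec 0) (sp 0 0)))} = UNIV"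
      using \<epsilon>(2) by (auto simp: )
    then have "good \<epsilon> 0 {0}"
      using infinite_UNIV_nat by (simp add: good_def unit_square_sum_def)
    then show "\<exists>z. good \<epsilon> (fst z) (snd z)" by (intro exI[of _ "(0, {0})"]) simp
  next
    fix z assume "good \<epsilon> (fst z) (snd z)"
    from good_step[OF adm inf \<epsilon>(2) pos this]
    show "\<exists>z'. good \<epsilon> (fst z') (snd z') \<and> fst z < fst z' \<and> snd z \<subseteq> snd z'"
      by (metis fst_conv snd_conv)
  qed
  then obtain f where f: "\<And>t. good \<epsilon> (fst (f t)) (snd (f t))"
    "\<And>t. fst (f t) < fst (f (Suc t))" "\<And>t. snd (f t) \<subseteq> snd (f (Suc t))"
    by auto
  then show ?thesis
    using \<epsilon>(1) by (intro exI[of _ \<epsilon>] exI[of _ "\<lambda>t. fst (f t)"] exI[of _ "\<lambda>t. snd (f t)"])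
      (simp add: strict_mono_Suc_iff)
qed

end

section \<open>Exponentials in the square-integrable functions of a measure on the cube\<close>

lemma cmod_add_square_le: "(cmod (a + b))\<^sup>2 \<le> 2 * (cmod a)\<^sup>2 + 2 * (cmod b)\<^sup>2"
proof -
  have "(cmod (a + b))\<^sup>2 \<le> (cmod a + cmod b)\<^sup>2"
    by (intro power_mono norm_triangle_ineq) auto
  also have "\<dots> \<le> 2 * (cmod a)\<^sup>2 + 2 * (cmod b)\<^sup>2"
    using sum_squares_bound[of "cmod a" "cmod b"] by (simp add: power2_sum)
  finally show ?thesis .
qed

locale cube_measure = prob_space M for M :: "(real^'d::finite) measure" +
  assumes sets_M [measurable_cong]: "sets M = sets borel"
    and AE_cube: "AE x in M. x \<in> unit_cube"
begin

lemma space_M [simp]: "space M = UNIV"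
  using sets_eq_imp_space_eq[OF sets_M] by simp

lemma prob_UNIV [simp]: "prob UNIV = 1"
  using prob_space by simp

definition sq_integrable :: "(real^'d \<Rightarrow> complex) \<Rightarrow> bool" where
  "sq_integrable f \<longleftrightarrow> f \<in> borel_measurable borel \<and> integrable M (\<lambda>x. (cmod (f x))\<^sup>2)"

definition approximable :: "(real^'d) set \<Rightarrow> (real^'d \<Rightarrow> complex) \<Rightarrow> bool" where
  "approximable Lam f \<longleftrightarrow> (\<forall>e>0. \<exists>F c. finite F \<and> F \<subseteq> Lam \<and>
     (\<integral>x. (cmod (f x - (\<Sum>l\<in>F. c l * expo l x)))\<^sup>2 \<partial>M) < e)"

lemma sq_integrable_bounded:
  assumes [measurable]: "f \<in> borel_measurable borel" and "\<And>x. cmod (f x) \<le> C"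
  shows "sq_integrable f"
  unfolding sq_integrable_def
proof
  have "(cmod (f x))\<^sup>2 \<le> C\<^sup>2" for x
    using assms(2)[of x] by (intro power_mono) auto
  then show "integrable M (\<lambda>x. (cmod (f x))\<^sup>2)"
    by (intro integrable_const_bound[of _ "C\<^sup>2"]) auto
qed fact

lemma sq_integrable_scale: "sq_integrable f \<Longrightarrow> sq_integrable (\<lambda>x. c * f x)"
  by (auto simp: sq_integrable_def norm_mult power_mult_distrib)

lemma sq_integrable_add:
  assumes "sq_integrable f" "sq_integrable g"
  shows "sq_integrable (\<lambda>x. f x + g x)"
proof -
  have [measurable]: "f \<in> borel_measurable borel" "g \<in> borel_measurable borel"
    using assms by (auto simp: sq_integrable_def)
  have "integrable M (\<lambda>x. 2 * (cmod (f x))\<^sup>2 + 2 * (cmod (g x))\<^sup>2)"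
    using assms by (auto simp: sq_integrable_def)
  then have "integrable M (\<lambda>x. (cmod (f x + g x))\<^sup>2)"
    by (rule Bochner_Integration.integrable_bound) (auto simp: cmod_add_square_le)
  then show ?thesis by (simp add: sq_integrable_def)
qed

lemma sq_integrable_diff:
  "sq_integrable f \<Longrightarrow> sq_integrable g \<Longrightarrow> sq_integrable (\<lambda>x. f x - g x)"
  using sq_integrable_add[OF _ sq_integrable_scale[of g "-1"]] by simp

lemma sq_integrable_sum:
  "finite F \<Longrightarrow> (\<And>i. i \<in> F \<Longrightarrow> sq_integrable (f i)) \<Longrightarrow> sq_integrable (\<lambda>x. \<Sum>i\<in>F. f i x)"
  by (induction F rule: finite_induct)
     (auto intro: sq_integrable_add sq_integrable_bounded[of _ 0])

lemma sq_integrable_trig: "finite F \<Longrightarrow> sq_integrable (\<lambda>x. \<Sum>l\<in>F. c l * expo l x)"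
  by (intro sq_integrable_sum sq_integrable_scale sq_integrable_bounded[of _ 1]) auto

lemma integral_square_add_le:
  assumes "sq_integrable f" "sq_integrable g"
  shows "(\<integral>x. (cmod (f x + g x))\<^sup>2 \<partial>M) \<le> 2 * (\<integral>x. (cmod (f x))\<^sup>2 \<partial>M) + 2 * (\<integral>x. (cmod (g x))\<^sup>2 \<partial>M)"
proof -
  have int: "integrable M (\<lambda>x. (cmod (f x))\<^sup>2)" "integrable M (\<lambda>x. (cmod (g x))\<^sup>2)"
    "integrable M (\<lambda>x. (cmod (f x + g x))\<^sup>2)"
    using assms sq_integrable_add[OF assms] by (auto simp: sq_integrable_def)
  have "(\<integral>x. (cmod (f x + g x))\<^sup>2 \<partial>M) \<le> (\<integral>x. 2 * (cmod (f x))\<^sup>2 + 2 * (cmod (g x))\<^sup>2 \<partial>M)"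
    using int by (intro integral_mono) (auto simp: cmod_add_square_le)
  also have "\<dots> = 2 * (\<integral>x. (cmod (f x))\<^sup>2 \<partial>M) + 2 * (\<integral>x. (cmod (g x))\<^sup>2 \<partial>M)"
    using int by simp
  finally show ?thesis .
qed

lemma approximable_limit:
  assumes "sq_integrable f"
    and ex: "\<And>e. 0 < e \<Longrightarrow> \<exists>g. sq_integrable g \<and> approximable Lam g \<and> (\<integral>x. (cmod (f x - g x))\<^sup>2 \<partial>M) < e"
  shows "approximable Lam f"
  unfolding approximable_def
proof (intro allI impI)
  fix e :: real assume "0 < e"
  then have e4: "0 < e / 4" by simp
  obtain g where g: "sq_integrable g" "approximable Lam g" "(\<integral>x. (cmod (f x - g x))\<^sup>2 \<partial>M) < e/4"
    using ex[OF e4] by blast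
  obtain F c where F: "finite F" "F \<subseteq> Lam" "(\<integral>x. (cmod (g x - (\<Sum>l\<in>F. c l * expo l x)))\<^sup>2 \<partial>M) < e/4"
    using g(2) e4 unfolding approximable_def by meson
  have "(\<integral>x. (cmod (f x - (\<Sum>l\<in>F. c l * expo l x)))\<^sup>2 \<partial>M)
      = (\<integral>x. (cmod ((f x - g x) + (g x - (\<Sum>l\<in>F. c l * expo l x))))\<^sup>2 \<partial>M)"
    by simp
  also have "\<dots> \<le> 2 * (\<integral>x. (cmod (f x - g x))\<^sup>2 \<partial>M) + 2 * (\<integral>x. (cmod (g x - (\<Sum>l\<in>F. c l * expo l x)))\<^sup>2 \<partial>M)"
    by (intro integral_square_add_le sq_integrable_diff assms g sq_integrable_trig F)
  also have "\<dots> < e" using g(3) F(3) by simp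
  finally show "\<exists>F c. finite F \<and> F \<subseteq> Lam \<and> (\<integral>x. (cmod (f x - (\<Sum>l\<in>F. c l * expo l x)))\<^sup>2 \<partial>M) < e"
    using F by blast
qed

lemma approximable_dominated_limit:
  assumes f: "sq_integrable f" and g: "\<And>n. sq_integrable (g n)" "\<And>n. approximable Lam (g n)"
    and lim: "\<And>x. (\<lambda>n. g n x) \<longlonglongrightarrow> f x"
    and w: "integrable M w" "\<And>n x. (cmod (f x - g n x))\<^sup>2 \<le> w x"
  shows "approximable Lam f"
proof (rule approximable_limit[OF f])
  fix e :: real assume "0 < e"
  have [measurable]: "f \<in> borel_measurable borel" "\<And>n. g n \<in> borel_measurable borel"
    using f g by (auto simp: sq_integrable_def)
  have "(\<lambda>n. \<integral>x. (cmod (f x - g n x))\<^sup>2 \<partial>M) \<longlonglongrightarrow> (\<integral>x. 0 \<partial>M)"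
  proof (rule integral_dominated_convergence)
    have "(\<lambda>n. (cmod (f x - g n x))\<^sup>2) \<longlonglongrightarrow> 0" for x
      using lim[of x] by (auto intro!: tendsto_eq_intros)
    then show "AE x in M. (\<lambda>n. (cmod (f x - g n x))\<^sup>2) \<longlonglongrightarrow> 0" by simp
  qed (use w in auto)
  then have "eventually (\<lambda>n. (\<integral>x. (cmod (f x - g n x))\<^sup>2 \<partial>M) < e) sequentially"
    using \<open>0 < e\<close> by (intro order_tendstoD) auto
  then obtain n where "(\<integral>x. (cmod (f x - g n x))\<^sup>2 \<partial>M) < e"
    by (auto simp: eventually_sequentially)
  then show "\<exists>h. sq_integrable h \<and> approximable Lam h \<and> (\<integral>x. (cmod (f x - h x))\<^sup>2 \<partial>M) < e"
    using g by blast
qed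

lemma approximable_scale:
  assumes "approximable Lam f"
  shows "approximable Lam (\<lambda>x. a * f x)"
  unfolding approximable_def
proof (intro allI impI)
  fix e :: real assume "0 < e"
  define r where "r = 1 + (cmod a)\<^sup>2"
  have r: "0 < r" "(cmod a)\<^sup>2 < r" by (auto simp: r_def add_pos_nonneg)
  then have er: "0 < e / r" using \<open>0 < e\<close> by simp
  obtain F c where F: "finite F" "F \<subseteq> Lam" "(\<integral>x. (cmod (f x - (\<Sum>l\<in>F. c l * expo l x)))\<^sup>2 \<partial>M) < e / r"
    using assms er unfolding approximable_def by meson
  let ?I = "\<integral>x. (cmod (f x - (\<Sum>l\<in>F. c l * expo l x)))\<^sup>2 \<partial>M"
  have "(\<integral>x. (cmod (a * f x - (\<Sum>l\<in>F. (a * c l) * expo l x)))\<^sup>2 \<partial>M) = (cmod a)\<^sup>2 * ?I"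
  proof -
    have "a * f x - (\<Sum>l\<in>F. (a * c l) * expo l x) = a * (f x - (\<Sum>l\<in>F. c l * expo l x))" for x
      by (simp add: right_diff_distrib sum_distrib_left mult.assoc)
    then show ?thesis by (simp only: norm_mult power_mult_distrib integral_mult_right_zero)
  qed
  also have "\<dots> \<le> r * ?I" using r by (intro mult_right_mono Bochner_Integration.integral_nonneg) auto
  also have "\<dots> < e" using F(3) r by (simp add: field_simps)
  finally have "(\<integral>x. (cmod (a * f x - (\<Sum>l\<in>F. (a * c l) * expo l x)))\<^sup>2 \<partial>M) < e" .
  then show "\<exists>F c. finite F \<and> F \<subseteq> Lam \<and> (\<integral>x. (cmod (a * f x - (\<Sum>l\<in>F. c l * expo l x)))\<^sup>2 \<partial>M) < e"
    using F(1,2) by (intro exI[of _ F] exI[of _ "\<lambda>l. a * c l"]) simp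
qed

lemma approximable_add:
  assumes f: "sq_integrable f" "approximable Lam f" and g: "sq_integrable g" "approximable Lam g"
  shows "approximable Lam (\<lambda>x. f x + g x)"
  unfolding approximable_def
proof (intro allI impI)
  fix e :: real assume "0 < e"
  then have e4: "0 < e / 4" by simp
  obtain F c where F: "finite F" "F \<subseteq> Lam" "(\<integral>x. (cmod (f x - (\<Sum>l\<in>F. c l * expo l x)))\<^sup>2 \<partial>M) < e/4"
    using f(2) e4 unfolding approximable_def by meson
  obtain G d where G: "finite G" "G \<subseteq> Lam" "(\<integral>x. (cmod (g x - (\<Sum>l\<in>G. d l * expo l x)))\<^sup>2 \<partial>M) < e/4"
    using g(2) e4 unfolding approximable_def by meson
  define h where "h l = (if l \<in> F then c l else 0) + (if l \<in> G then d l else 0)" for l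
  have h: "(\<Sum>l\<in>F. c l * expo l x) + (\<Sum>l\<in>G. d l * expo l x) = (\<Sum>l\<in>F\<union>G. h l * expo l x)" for x
  proof -
    have "(\<Sum>l\<in>F. c l * expo l x) = (\<Sum>l\<in>F\<union>G. (if l \<in> F then c l else 0) * expo l x)"
      using F G by (intro sum.mono_neutral_cong_left) auto
    moreover have "(\<Sum>l\<in>G. d l * expo l x) = (\<Sum>l\<in>F\<union>G. (if l \<in> G then d l else 0) * expo l x)"
      using F G by (intro sum.mono_neutral_cong_left) auto
    ultimately show ?thesis
      by (simp add: h_def sum.distrib[symmetric] distrib_right)
  qed
  have "(\<integral>x. (cmod ((f x + g x) - (\<Sum>l\<in>F\<union>G. h l * expo l x)))\<^sup>2 \<partial>M)
      = (\<integral>x. (cmod ((f x - (\<Sum>l\<in>F. c l * expo l x)) + (g x - (\<Sum>l\<in>G. d l * expo l x))))\<^sup>2 \<partial>M)"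
    by (simp add: h[symmetric] algebra_simps)
  also have "\<dots> \<le> 2 * (\<integral>x. (cmod (f x - (\<Sum>l\<in>F. c l * expo l x)))\<^sup>2 \<partial>M)
      + 2 * (\<integral>x. (cmod (g x - (\<Sum>l\<in>G. d l * expo l x)))\<^sup>2 \<partial>M)"
    by (intro integral_square_add_le sq_integrable_diff f g sq_integrable_trig F G)
  also have "\<dots> < e" using F(3) G(3) by simp
  finally show "\<exists>F c. finite F \<and> F \<subseteq> Lam \<and> (\<integral>x. (cmod (f x + g x - (\<Sum>l\<in>F. c l * expo l x)))\<^sup>2 \<partial>M) < e"
    using F(1,2) G(1,2) by (intro exI[of _ "F \<union> G"] exI[of _ h]) simp
qed

lemma approximable_zero: "approximable Lam (\<lambda>_. 0)"
  unfolding approximable_def by (intro allI impI exI[of _ "{}"]) simp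

lemma approximable_sum:
  assumes "finite F" "\<And>i. i \<in> F \<Longrightarrow> sq_integrable (f i)" "\<And>i. i \<in> F \<Longrightarrow> approximable Lam (f i)"
  shows "approximable Lam (\<lambda>x. \<Sum>i\<in>F. f i x)"
  using assms
proof (induction F rule: finite_induct)
  case empty
  show ?case by (simp add: approximable_zero)
next
  case (insert i F)
  have "approximable Lam (\<lambda>x. f i x + (\<Sum>i\<in>F. f i x))"
    using insert by (intro approximable_add sq_integrable_sum) simp_all
  then show ?case using insert by simp
qed

lemma sq_integrable_indicator: "A \<in> sets borel \<Longrightarrow> sq_integrable (indicator A)"
  by (intro sq_integrable_bounded[of _ 1]) (auto simp: indicator_def)

section \<open>Density: from exponentials of all real frequencies to square-integrable
  functions\<close>

context
  fixes Lam :: "(real^'d) set"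
  assumes expo_approximable: "\<And>\<xi>. approximable Lam (expo \<xi>)"
begin

text \<open>The measure sees only the cube, where trigonometric polynomials with arbitrary real
  frequencies are uniformly dense. Their frequencies need not lie in \<open>Lam\<close>, because
  every exponential is assumed approximable.\<close>

lemma approximable_continuous:
  assumes f: "continuous_on UNIV f" "\<And>x. cmod (f x) \<le> C"
  shows "approximable Lam f"
proof (rule approximable_limit)
  have fm [measurable]: "f \<in> borel_measurable borel" by (intro borel_measurable_continuous_onI f)
  show sqf: "sq_integrable f" by (rule sq_integrable_bounded[OF fm f(2)])
  fix e :: real assume "0 < e"
  define \<delta> where "\<delta> = sqrt (e / 2)"
  have \<delta>: "0 < \<delta>" "\<delta>\<^sup>2 = e / 2" using \<open>0 < e\<close> by (auto simp: \<delta>_def)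
  obtain F c where F: "finite F" "\<And>x. x \<in> unit_cube \<Longrightarrow> cmod (f x - (\<Sum>l\<in>F. c l * expo l x)) < \<delta>"
    using trig_poly_approx_cube[OF continuous_on_subset[OF f(1)] \<delta>(1)] by auto
  let ?T = "\<lambda>x. \<Sum>l\<in>F. c l * expo l x"
  have T: "sq_integrable ?T" by (rule sq_integrable_trig[OF F(1)])
  moreover have "approximable Lam ?T"
    by (intro approximable_sum F approximable_scale expo_approximable sq_integrable_scale
        sq_integrable_bounded[of _ 1]) auto
  moreover have "(\<integral>x. (cmod (f x - ?T x))\<^sup>2 \<partial>M) < e"
  proof -
    have "(\<integral>x. (cmod (f x - ?T x))\<^sup>2 \<partial>M) \<le> (\<integral>x. e / 2 \<partial>M)"
    proof (rule integral_mono_AE)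
      show "integrable M (\<lambda>x. (cmod (f x - ?T x))\<^sup>2)"
        using sq_integrable_diff[OF sqf T] by (simp add: sq_integrable_def)
      show "AE x in M. (cmod (f x - ?T x))\<^sup>2 \<le> e / 2"
        using AE_cube
      proof eventually_elim
        case (elim x)
        then have "(cmod (f x - ?T x))\<^sup>2 \<le> \<delta>\<^sup>2"
          using F(2)[OF elim] by (intro power_mono) auto
        then show ?case by (simp add: \<delta>(2))
      qed
    qed auto
    also have "\<dots> < e" using \<open>0 < e\<close> by (simp add: prob_space)
    finally show ?thesis .
  qed
  ultimately show "\<exists>g. sq_integrable g \<and> approximable Lam g \<and> (\<integral>x. (cmod (f x - g x))\<^sup>2 \<partial>M) < e"
    by blast
qed

lemma approximable_indicator_closed:
  assumes "closed A" shows "approximable Lam (indicator A)"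
proof (cases "A = {}")
  case True
  then have "indicator A = (\<lambda>_. 0 :: complex)" by auto
  then show ?thesis by (simp add: approximable_zero)
next
  case False
  define g where "g n x = complex_of_real (max 0 (1 - real n * infdist x A))" for n x
  have gb: "cmod (g n x) \<le> 1" for n x
    by (simp add: g_def infdist_nonneg)
  have contg: "continuous_on UNIV (g n)" for n
    unfolding g_def by (intro continuous_intros)
  show ?thesis
  proof (rule approximable_dominated_limit[where g = g and w = "\<lambda>_. 4"])
    show "sq_integrable (indicator A)" using assms by (intro sq_integrable_indicator) auto
    show "sq_integrable (g n)" for n
      using gb contg by (intro sq_integrable_bounded[of _ 1] borel_measurable_continuous_onI)
    show "approximable Lam (g n)" for n
      by (rule approximable_continuous[OF contg gb])
    show "(\<lambda>n. g n x) \<longlonglongrightarrow> indicator A x" for x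
    proof (cases "x \<in> A")
      case True
      then show ?thesis by (simp add: g_def)
    next
      case False
      then have pos: "0 < infdist x A"
        using assms \<open>A \<noteq> {}\<close> in_closed_iff_infdist_zero[of A x] infdist_nonneg[of x A] by simp
      obtain N where N: "1 < real N * infdist x A"
        using reals_Archimedean3[OF pos] by blast
      have "g n x = 0" if "N \<le> n" for n
      proof -
        have "real N * infdist x A \<le> real n * infdist x A"
          using that pos by (intro mult_right_mono) auto
        then show ?thesis using N by (simp add: g_def)
      qed
      then have "eventually (\<lambda>n. g n x = indicator A x) sequentially"
        using False by (auto simp: eventually_sequentially)
      then show ?thesis by (rule tendsto_eventually)
    qed
    fix n x
    have "cmod (indicator A x - g n x) \<le> cmod (indicator A x) + cmod (g n x)"
      by (rule norm_triangle_ineq4)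
    also have "\<dots> \<le> 2" using gb[of n x] by (simp add: indicator_def)
    finally have "(cmod (indicator A x - g n x))\<^sup>2 \<le> 2\<^sup>2" by (intro power_mono) auto
    then show "(cmod (indicator A x - g n x))\<^sup>2 \<le> 4" by simp
  qed simp
qed

text \<open>Closed sets form an intersection-stable generator of the Borel sets. Complements follow
  by linearity and disjoint unions by dominated convergence.\<close>

lemma approximable_indicator:
  assumes "A \<in> sets borel" shows "approximable Lam (indicator A)"
proof -
  have "Int_stable (Collect (closed :: (real^'d) set \<Rightarrow> bool))"
    by (auto simp: Int_stable_def)
  moreover have "Collect (closed :: (real^'d) set \<Rightarrow> bool) \<subseteq> Pow UNIV" by simp
  moreover have "A \<in> sigma_sets UNIV (Collect closed)"
    using assms by (simp add: borel_eq_closed)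
  ultimately show ?thesis
  proof (induction rule: sigma_sets_induct_disjoint)
    case (basic A)
    then show ?case by (simp add: approximable_indicator_closed)
  next
    case empty
    have "indicator {} = (\<lambda>_. 0 :: complex)" by auto
    then show ?case by (simp add: approximable_zero)
  next
    case (compl A)
    have A: "A \<in> sets borel" using compl by (simp add: borel_eq_closed)
    have "approximable Lam (\<lambda>_. 1)" "sq_integrable (\<lambda>_. 1)"
      by (auto intro: approximable_continuous[of _ 1] sq_integrable_bounded[of _ 1])
    then have "approximable Lam (\<lambda>x. 1 + (-1) * indicator A x)"
      using compl by (intro approximable_add approximable_scale sq_integrable_scale sq_integrable_indicator A)
    moreover have "(\<lambda>x. 1 + (-1) * indicator A x) = (indicator (UNIV - A) :: _ \<Rightarrow> complex)"
      by (auto simp: indicator_def fun_eq_iff)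
    ultimately show ?case by simp
  next
    case (union A)
    have A: "A i \<in> sets borel" for i using union(2) by (auto simp: borel_eq_closed)
    show ?case
    proof (rule approximable_dominated_limit[where w = "\<lambda>_. 1"
          and g = "\<lambda>n x. \<Sum>i<n. indicator (A i) x"])
      show "sq_integrable (indicator (\<Union>i. A i))" using A by (intro sq_integrable_indicator) auto
      show "sq_integrable (\<lambda>x. \<Sum>i<n. indicator (A i) x)" for n
        using A by (intro sq_integrable_sum sq_integrable_indicator) auto
      show "approximable Lam (\<lambda>x. \<Sum>i<n. indicator (A i) x)" for n
        using A union(3) by (intro approximable_sum sq_integrable_indicator) auto
      have sum_eq: "(\<Sum>i<n. indicator (A i) x) = (indicator (\<Union>i<n. A i) x :: complex)" for n x
        using union(1) by (intro indicator_UN_disjoint[symmetric]) (auto simp: disjoint_family_on_def)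
      show "(\<lambda>n. \<Sum>i<n. indicator (A i) x) \<longlonglongrightarrow> (indicator (\<Union>i. A i) x :: complex)" for x
        unfolding sum_eq by (rule LIMSEQ_indicator_UN)
      fix n x
      show "(cmod (indicator (\<Union>i. A i) x - (\<Sum>i<n. indicator (A i) x)))\<^sup>2 \<le> 1"
        unfolding sum_eq by (auto simp: indicator_def)
    qed simp
  qed
qed

lemma approximable_sq_integrable:
  assumes f: "sq_integrable f" shows "approximable Lam f"
proof -
  have fm [measurable]: "f \<in> borel_measurable borel" and int: "integrable M (\<lambda>x. (cmod (f x))\<^sup>2)"
    using f by (auto simp: sq_integrable_def)
  obtain s where s: "\<And>i. simple_function borel (s i)" "\<And>x. (\<lambda>i. s i x) \<longlonglongrightarrow> f x"
    "\<And>i x. cmod (s i x) \<le> 2 * cmod (f x)"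
    using borel_measurable_implies_sequence_metric[OF fm, of 0] by auto
  have simple: "sq_integrable (s i) \<and> approximable Lam (s i)" for i
  proof -
    have fin: "finite (range (s i))"
      using simple_functionD(1)[OF s(1)[of i]] by simp
    have meas: "s i -` {y} \<in> sets borel" for y
      using simple_functionD(2)[OF s(1)[of i], of "{y}"] by simp
    have eq: "s i = (\<lambda>x. \<Sum>y\<in>range (s i). y * indicator (s i -` {y}) x)"
    proof
      fix x
      have "(\<Sum>y\<in>range (s i). y * indicator (s i -` {y}) x) = (\<Sum>y\<in>range (s i). if s i x = y then y else 0)"
        by (intro sum.cong refl) (auto simp: indicator_def)
      also have "\<dots> = s i x" using fin by simp
      finally show "s i x = (\<Sum>y\<in>range (s i). y * indicator (s i -` {y}) x)" by simp
    qed
    have "sq_integrable (\<lambda>x. \<Sum>y\<in>range (s i). y * indicator (s i -` {y}) x)"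
      by (intro sq_integrable_sum fin sq_integrable_scale sq_integrable_indicator meas)
    moreover have "approximable Lam (\<lambda>x. \<Sum>y\<in>range (s i). y * indicator (s i -` {y}) x)"
      by (intro approximable_sum fin sq_integrable_scale sq_integrable_indicator meas
          approximable_scale approximable_indicator)
    ultimately show ?thesis using eq by simp
  qed
  show ?thesis
  \<comment> \<open>The simple functions satisfy |s| \<le> 2 |f|, so the error is at most 3 |f|;
    hence the factor 9.\<close>
  proof (rule approximable_dominated_limit[where g = s and w = "\<lambda>x. 9 * (cmod (f x))\<^sup>2"])
    fix n x
    have "cmod (f x - s n x) \<le> cmod (f x) + cmod (s n x)"
      by (rule norm_triangle_ineq4)
    also have "\<dots> \<le> 3 * cmod (f x)" using s(3)[of n x] by simp
    finally have "(cmod (f x - s n x))\<^sup>2 \<le> (3 * cmod (f x))\<^sup>2" by (intro power_mono) auto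
    then show "(cmod (f x - s n x))\<^sup>2 \<le> 9 * (cmod (f x))\<^sup>2" by (simp add: power_mult_distrib)
  qed (use f simple s int in auto)
qed

end

section \<open>Parseval defect of an orthogonal family of exponentials\<close>

definition char_fn :: "real^'d \<Rightarrow> complex" where
  "char_fn \<xi> = (\<integral>x. expo \<xi> x \<partial>M)"

lemma integrable_expo: "integrable M (expo \<xi>)"
  by (intro integrable_const_bound[of _ 1]) auto

lemma char_fn_zero [simp]: "char_fn 0 = 1"
  by (simp add: char_fn_def prob_space)

lemma char_fn_minus: "char_fn (- \<xi>) = cnj (char_fn \<xi>)"
  by (simp add: char_fn_def expo_minus)

text \<open>Expanding the square gives 1 - N - N + N, where N is the sum of the squared
  coefficients: both cross terms equal N, and orthogonality reduces the double sum to its diagonal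
  N.\<close>

lemma integral_square_orthogonal_projection:
  assumes F: "finite F" and orth: "\<And>l l'. l \<in> F \<Longrightarrow> l' \<in> F \<Longrightarrow> l \<noteq> l' \<Longrightarrow> char_fn (l - l') = 0"
  shows "(\<integral>x. (cmod (expo \<xi> x - (\<Sum>l\<in>F. char_fn (\<xi> - l) * expo l x)))\<^sup>2 \<partial>M)
          = 1 - (\<Sum>l\<in>F. (cmod (char_fn (\<xi> - l)))\<^sup>2)"
proof -
  let ?c = "\<lambda>l. char_fn (\<xi> - l)"
  let ?N = "\<Sum>l\<in>F. complex_of_real ((cmod (?c l))\<^sup>2)"
  have "complex_of_real ((cmod (expo \<xi> x - (\<Sum>l\<in>F. ?c l * expo l x)))\<^sup>2)
      = 1 - (\<Sum>l\<in>F. cnj (?c l) * expo (\<xi> - l) x) - (\<Sum>l\<in>F. ?c l * expo (l - \<xi>) x)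
        + (\<Sum>l\<in>F. \<Sum>l'\<in>F. ?c l * cnj (?c l') * expo (l - l') x)" for x
  proof -
    have 1: "expo \<xi> x * cnj (expo \<xi> x) = 1" by (simp add: complex_norm_square[symmetric])
    let ?S = "\<Sum>l\<in>F. ?c l * expo l x"
    have 2: "expo \<xi> x * cnj ?S = (\<Sum>l\<in>F. cnj (?c l) * expo (\<xi> - l) x)"
      by (simp add: sum_distrib_left expo_diff mult_ac)
    have 3: "?S * cnj (expo \<xi> x) = (\<Sum>l\<in>F. ?c l * expo (l - \<xi>) x)"
      unfolding sum_distrib_right by (simp add: expo_diff mult_ac)
    have 4: "?S * cnj ?S = (\<Sum>l\<in>F. \<Sum>l'\<in>F. ?c l * cnj (?c l') * expo (l - l') x)"
      unfolding cnj_sum sum_product by (simp add: expo_diff mult_ac)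
    have "(expo \<xi> x - ?S) * cnj (expo \<xi> x - ?S)
        = expo \<xi> x * cnj (expo \<xi> x) - expo \<xi> x * cnj ?S - ?S * cnj (expo \<xi> x) + ?S * cnj ?S"
      unfolding complex_cnj_diff by (simp only: algebra_simps)
    then show ?thesis
      unfolding complex_norm_square 1 2 3 4 .
  qed
  then have "complex_of_real (\<integral>x. (cmod (expo \<xi> x - (\<Sum>l\<in>F. ?c l * expo l x)))\<^sup>2 \<partial>M)
      = (\<integral>x. 1 - (\<Sum>l\<in>F. cnj (?c l) * expo (\<xi> - l) x) - (\<Sum>l\<in>F. ?c l * expo (l - \<xi>) x)
        + (\<Sum>l\<in>F. \<Sum>l'\<in>F. ?c l * cnj (?c l') * expo (l - l') x) \<partial>M)"
    by (simp only: integral_complex_of_real[symmetric])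
  also have "\<dots> = 1 - (\<Sum>l\<in>F. cnj (?c l) * char_fn (\<xi> - l)) - (\<Sum>l\<in>F. ?c l * char_fn (l - \<xi>))
        + (\<Sum>l\<in>F. \<Sum>l'\<in>F. ?c l * cnj (?c l') * char_fn (l - l'))"
    by (simp add: integrable_expo char_fn_def prob_space)
  also have "(\<Sum>l\<in>F. cnj (?c l) * char_fn (\<xi> - l)) = ?N"
    by (simp only: complex_norm_square mult.commute)
  also have "(\<Sum>l\<in>F. ?c l * char_fn (l - \<xi>)) = ?N"
    unfolding complex_norm_square by (intro sum.cong refl) (metis char_fn_minus minus_diff_eq)
  also have "(\<Sum>l\<in>F. \<Sum>l'\<in>F. ?c l * cnj (?c l') * char_fn (l - l')) = ?N"
  proof (intro sum.cong refl)
    fix l assume l: "l \<in> F"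
    have "(\<Sum>l'\<in>F. ?c l * cnj (?c l') * char_fn (l - l'))
        = (\<Sum>l'\<in>{l}. ?c l * cnj (?c l') * char_fn (l - l'))"
      using F l orth by (intro sum.mono_neutral_right) auto
    then show "(\<Sum>l'\<in>F. ?c l * cnj (?c l') * char_fn (l - l')) = complex_of_real ((cmod (?c l))\<^sup>2)"
      unfolding complex_norm_square by simp
  qed
  finally have "complex_of_real (\<integral>x. (cmod (expo \<xi> x - (\<Sum>l\<in>F. ?c l * expo l x)))\<^sup>2 \<partial>M)
      = complex_of_real (1 - (\<Sum>l\<in>F. (cmod (?c l))\<^sup>2))"
    by simp
  then show ?thesis by (simp only: of_real_eq_iff)
qed

lemma bessel:
  assumes "finite F" "\<And>l l'. l \<in> F \<Longrightarrow> l' \<in> F \<Longrightarrow> l \<noteq> l' \<Longrightarrow> char_fn (l - l') = 0"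
  shows "(\<Sum>l\<in>F. (cmod (char_fn (\<xi> - l)))\<^sup>2) \<le> 1"
proof -
  have "0 \<le> (\<integral>x. (cmod (expo \<xi> x - (\<Sum>l\<in>F. char_fn (\<xi> - l) * expo l x)))\<^sup>2 \<partial>M)"
    by (intro Bochner_Integration.integral_nonneg) simp
  then show ?thesis
    using integral_square_orthogonal_projection[OF assms] by simp
qed

text \<open>Parseval's identity makes the projection error of each exponential arbitrarily small,
  and density extends this to every square-integrable function.\<close>

lemma is_spectrum_if_parseval:
  assumes "countable Lam"
    and orth: "\<And>l l'. l \<in> Lam \<Longrightarrow> l' \<in> Lam \<Longrightarrow> l \<noteq> l' \<Longrightarrow> char_fn (l - l') = 0"
    and parseval: "\<And>\<xi> e. 0 < e \<Longrightarrow> \<exists>F. finite F \<and> F \<subseteq> Lam \<and> 1 - e < (\<Sum>l\<in>F. (cmod (char_fn (\<xi> - l)))\<^sup>2)"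
  shows "is_spectrum M Lam"
proof -
  have "approximable Lam (expo \<xi>)" for \<xi>
    unfolding approximable_def
  proof (intro allI impI)
    fix e :: real assume "0 < e"
    then obtain F where F: "finite F" "F \<subseteq> Lam" "1 - e < (\<Sum>l\<in>F. (cmod (char_fn (\<xi> - l)))\<^sup>2)"
      using parseval by blast
    have "(\<integral>x. (cmod (expo \<xi> x - (\<Sum>l\<in>F. char_fn (\<xi> - l) * expo l x)))\<^sup>2 \<partial>M)
          = 1 - (\<Sum>l\<in>F. (cmod (char_fn (\<xi> - l)))\<^sup>2)"
      using F orth by (intro integral_square_orthogonal_projection) auto
    then show "\<exists>F c. finite F \<and> F \<subseteq> Lam \<and> (\<integral>x. (cmod (expo \<xi> x - (\<Sum>l\<in>F. c l * expo l x)))\<^sup>2 \<partial>M) < e"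
      using F by (intro exI[of _ F] exI[of _ "\<lambda>l. char_fn (\<xi> - l)"]) simp
  qed
  then have "approximable Lam f" if "sq_integrable f" for f
    using approximable_sq_integrable that by blast
  moreover have "(\<integral>x. expo l x * cnj (expo l' x) \<partial>M) = (if l = l' then 1 else 0)"
    if "l \<in> Lam" "l' \<in> Lam" for l l'
    using orth[OF that] by (auto simp: char_fn_def expo_diff complex_norm_square[symmetric] prob_space)
  moreover have "borel_measurable M = borel_measurable borel"
    by (intro measurable_cong_sets sets_M refl)
  ultimately show ?thesis
    using assms(1) unfolding is_spectrum_def sq_integrable_def approximable_def by auto
qed

end

section \<open>The infinite convolution\<close>

lemma prob_space_delta_set: "prob_space (delta_set A)"
  unfolding delta_set_def by (intro prob_space.prob_space_distr measure_pmf.prob_space_axioms) simp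

lemma sets_delta_set [measurable_cong, simp]: "sets (delta_set A) = sets borel"
  by (simp add: delta_set_def)

lemma integral_convolution_delta_set:
  fixes f :: "real^'d::finite \<Rightarrow> 'b::{banach, second_countable_topology}"
  assumes M: "prob_space M" and sM [measurable_cong]: "sets M = sets borel" and A: "finite A" "A \<noteq> {}"
    and f [measurable]: "f \<in> borel_measurable borel" and bound: "\<And>x. norm (f x) \<le> C"
  shows "(\<integral>x. f x \<partial>convolution M (delta_set A)) = (\<integral>x. (\<Sum>a\<in>A. f (x + a)) /\<^sub>R real (card A) \<partial>M)"
proof -
  interpret M: prob_space M by fact
  interpret N: prob_space "delta_set A" by (rule prob_space_delta_set)
  interpret P: pair_prob_space M "delta_set A" ..
  have "(\<integral>x. f x \<partial>convolution M (delta_set A)) = (\<integral>p. f (fst p + snd p) \<partial>(M \<Otimes>\<^sub>M delta_set A))"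
    unfolding convolution_def by (subst integral_distr) (auto simp: split_beta)
  also have "\<dots> = (\<integral>x. (\<integral>y. f (fst (x, y) + snd (x, y)) \<partial>delta_set A) \<partial>M)"
    by (rule P.integral_fst'[symmetric], rule P.integrable_const_bound[of _ C]) (auto simp: bound)
  also have "\<dots> = (\<integral>x. (\<Sum>a\<in>A. f (x + a)) /\<^sub>R real (card A) \<partial>M)"
  proof (rule Bochner_Integration.integral_cong[OF refl])
    fix x
    have "(\<integral>y. f (x + y) \<partial>delta_set A) = measure_pmf.expectation (pmf_of_set A) (\<lambda>y. f (x + y))"
      unfolding delta_set_def by (subst integral_distr) auto
    also have "\<dots> = (\<Sum>a\<in>A. f (x + a)) /\<^sub>R real (card A)"
      using A by (subst integral_measure_pmf[of A]) (auto simp: scaleR_sum_right divide_inverse)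
    finally show "(\<integral>y. f (fst (x, y) + snd (x, y)) \<partial>delta_set A) = (\<Sum>a\<in>A. f (x + a)) /\<^sub>R real (card A)"
      by simp
  qed
  finally show ?thesis .
qed

lemma prob_space_convolution:
  assumes "prob_space M" "sets M = sets borel" "prob_space N" "sets N = sets borel"
  shows "prob_space (convolution M N)"
proof -
  interpret M: prob_space M by fact
  interpret N: prob_space N by fact
  interpret P: pair_prob_space M N ..
  note assms(2,4)[measurable_cong]
  show ?thesis
    unfolding convolution_def by (rule P.prob_space_distr) measurable
qed

lemma sets_conv_partial [measurable_cong, simp]: "sets (conv_partial ms Bs n) = sets borel"
  by (cases n) auto

lemma prob_space_conv_partial: "prob_space (conv_partial ms Bs n)"
proof (induction n)
  case 0
  show ?case by (simp add: prob_space_return)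
next
  case (Suc n)
  then show ?case by (simp add: prob_space_convolution prob_space_delta_set)
qed

context digit_sequence
begin

lemma scale_prod_eq_prod: "sp 0 n i = (\<Prod>k\<in>{1..n}. ms k i)"
proof (induction n)
  case (Suc n)
  then show ?case using scale_prod_add[of ms 0 n 1 i] by (simp add: mult.commute)
qed simp

lemma scaled_digits_eq:
  "scaled_digits ms Bs n = (\<lambda>b. vdiv (int_vec b) (sp 0 n)) ` Bs n"
  unfolding scaled_digits_def scale_prod_eq_prod
  by (intro image_cong refl) (simp add: vec_eq_iff scale_prod_eq_prod)

lemma inj_vdiv: "inj_on (\<lambda>b. vdiv (int_vec b) (sp 0 n)) X"
proof (rule inj_onI)
  fix a b :: "int^'d" assume eq: "vdiv (int_vec a) (sp 0 n) = vdiv (int_vec b) (sp 0 n)"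
  have "a$i = b$i" for i
  proof -
    have "vdiv (int_vec a) (sp 0 n) $ i = vdiv (int_vec b) (sp 0 n) $ i" using eq by simp
    then show ?thesis using scale_prod_pos[of 0 n i] by simp
  qed
  then show "a = b" by (simp add: vec_eq_iff)
qed

lemma finite_scaled_digits: "finite (scaled_digits ms Bs (Suc n))" "scaled_digits ms Bs (Suc n) \<noteq> {}"
  using in_D_finite[OF inD_Suc] inD_Suc[of n] by (auto simp: scaled_digits_eq in_D_def)

lemma integral_conv_partial_Suc:
  fixes f :: "real^'d \<Rightarrow> 'b::{banach, second_countable_topology}"
  assumes "f \<in> borel_measurable borel" "\<And>x. norm (f x) \<le> C"
  shows "(\<integral>x. f x \<partial>conv_partial ms Bs (Suc n)) =
    (\<integral>x. (\<Sum>b\<in>Bs (Suc n). f (x + vdiv (int_vec b) (sp 0 (Suc n)))) /\<^sub>R real (card (Bs (Suc n))) \<partial>conv_partial ms Bs n)"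
proof -
  have card: "card (scaled_digits ms Bs (Suc n)) = card (Bs (Suc n))"
    unfolding scaled_digits_eq by (rule card_image[OF inj_vdiv])
  have sum: "(\<Sum>a\<in>scaled_digits ms Bs (Suc n). f (x + a))
      = (\<Sum>b\<in>Bs (Suc n). f (x + vdiv (int_vec b) (sp 0 (Suc n))))" for x
    unfolding scaled_digits_eq by (subst sum.reindex[OF inj_vdiv]) simp
  show ?thesis
    unfolding conv_partial.simps
    by (subst integral_convolution_delta_set[OF prob_space_conv_partial sets_conv_partial finite_scaled_digits assms])
       (simp only: card sum)
qed

text \<open>\<open>conv_partial\<close> appends layers at the end while \<open>block_mask\<close>
  peels them from the front; \<open>block_mask_add\<close> with a second block of length 1
  reconciles the two.\<close>

lemma integral_expo_conv_partial: "(\<integral>x. expo \<xi> x \<partial>conv_partial ms Bs n) = bm 0 n \<xi>"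
proof (induction n)
  case 0
  show ?case by (simp add: integral_return)
next
  case (Suc n)
  let ?B = "Bs (Suc n)" and ?m = "ms (Suc n)"
  have digit: "expo \<xi> (vdiv (int_vec b) (sp 0 (Suc n))) = expo (vdiv \<xi> (sp 0 n)) (diag_inv_apply ?m b)" for b
  proof -
    have "sp 0 (Suc n) i = sp 0 n i * ?m i" for i
      using scale_prod_add[of ms 0 n 1 i] by simp
    then have "\<xi> \<bullet> vdiv (int_vec b) (sp 0 (Suc n)) = vdiv \<xi> (sp 0 n) \<bullet> diag_inv_apply ?m b"
      unfolding inner_vec_def by (intro sum.cong refl) (simp add: diag_inv_apply_def)
    then show ?thesis by (simp add: expo_def)
  qed
  have "(\<integral>x. expo \<xi> x \<partial>conv_partial ms Bs (Suc n))
      = (\<integral>x. expo \<xi> x * mask ?m ?B (vdiv \<xi> (sp 0 n)) \<partial>conv_partial ms Bs n)"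
    by (subst integral_conv_partial_Suc[of _ 1])
       (auto simp del: scale_prod.simps simp: expo_add_right digit mask_def sum_distrib_left[symmetric] scaleR_conv_of_real divide_inverse mult_ac)
  also have "\<dots> = bm 0 n \<xi> * mask ?m ?B (vdiv \<xi> (sp 0 n))"
    by (simp add: Suc.IH)
  also have "\<dots> = bm 0 (n + 1) \<xi>"
    unfolding block_mask_add by simp
  finally show ?case by simp
qed

text \<open>Concentration on a box, phrased through integrals. The upper corner 1 -
  1/\<open>sp 0 n i\<close> makes the induction close exactly: the largest digit of the next layer
  adds 1/\<open>sp 0 n i\<close> - 1/\<open>sp 0 (Suc n) i\<close>.\<close>

lemma integral_conv_partial_eq_0:
  fixes f :: "real^'d \<Rightarrow> real"
  assumes "f \<in> borel_measurable borel" "\<And>x. norm (f x) \<le> C"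
    and "\<And>x. (\<forall>i. 0 \<le> x$i \<and> x$i \<le> 1 - 1 / real (sp 0 n i)) \<Longrightarrow> f x = 0"
  shows "(\<integral>x. f x \<partial>conv_partial ms Bs n) = 0"
  using assms
proof (induction n arbitrary: f)
  case 0
  then show ?case by (simp add: integral_return)
next
  case (Suc n)
  let ?B = "Bs (Suc n)" and ?m = "ms (Suc n)"
  note [measurable] = Suc.prems(1)
  define g where "g x = (\<Sum>b\<in>?B. f (x + vdiv (int_vec b) (sp 0 (Suc n)))) /\<^sub>R real (card ?B)" for x
  have sp_Suc: "sp 0 (Suc n) i = sp 0 n i * ?m i" for i
    using scale_prod_add[of ms 0 n 1 i] by simp
  have cB: "0 < real (card ?B)" using in_D_card_pos[OF inD_Suc] by simp
  have "(\<integral>x. g x \<partial>conv_partial ms Bs n) = 0"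
  proof (rule Suc.IH)
    show "g \<in> borel_measurable borel" unfolding g_def by measurable
    show "norm (g x) \<le> C" for x
    proof -
      have "norm (\<Sum>b\<in>?B. f (x + vdiv (int_vec b) (sp 0 (Suc n)))) \<le> (\<Sum>b\<in>?B. C)"
        by (intro sum_norm_le Suc.prems(2))
      then show ?thesis using cB by (simp add: g_def field_simps)
    qed
  next
    fix x :: "real^'d" assume x: "\<forall>i. 0 \<le> x$i \<and> x$i \<le> 1 - 1 / real (sp 0 n i)"
    have "f (x + vdiv (int_vec b) (sp 0 (Suc n))) = 0" if b: "b \<in> ?B" for b
    proof (rule Suc.prems(3), intro allI)
      fix i
      have p: "0 < real (sp 0 n i)" "0 < real (?m i)"
        using scale_prod_pos[of 0 n i] ms_ge_2[of n i] by simp_all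
      have "0 \<le> b$i" "b$i \<le> int (?m i) - 1"
        using inD_Suc[of n] b by (auto simp: in_D_def)
      then have bi: "0 \<le> real_of_int (b$i)" "real_of_int (b$i) \<le> real (?m i) - 1"
        by linarith+
      have "real_of_int (b$i) / (real (sp 0 n i) * real (?m i)) \<le> (real (?m i) - 1) / (real (sp 0 n i) * real (?m i))"
        using bi p by (intro divide_right_mono) auto
      also have "\<dots> = 1 / real (sp 0 n i) - 1 / (real (sp 0 n i) * real (?m i))"
        using p by (simp add: field_simps)
      finally show "0 \<le> (x + vdiv (int_vec b) (sp 0 (Suc n))) $ i \<and>
          (x + vdiv (int_vec b) (sp 0 (Suc n))) $ i \<le> 1 - 1 / real (sp 0 (Suc n) i)"
        using x[rule_format, of i] bi p by (simp add: sp_Suc del: scale_prod.simps)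
    qed
    then show "g x = 0" by (simp add: g_def del: scale_prod.simps)
  qed
  then show ?case
    unfolding g_def by (subst integral_conv_partial_Suc[OF Suc.prems(1,2)])
qed

text \<open>The distance to the cube, cut off at 1, is a bounded continuous test function. It has
  integral 0 against every partial convolution, hence against the limit, so it vanishes almost
  everywhere.\<close>

lemma weak_limit_cube_measure:
  assumes "prob_space \<mu>" and sets: "sets \<mu> = sets borel" and lim: "weak_conv_vec (conv_partial ms Bs) \<mu>"
  shows "cube_measure \<mu>"
proof -
  interpret prob_space \<mu> by fact
  note sets [measurable_cong]
  define f :: "real^'d \<Rightarrow> real" where "f x = min 1 (infdist x unit_cube)" for x
  have cont: "continuous_on UNIV f" unfolding f_def by (intro continuous_intros)
  then have fm [measurable]: "f \<in> borel_measurable borel" by (rule borel_measurable_continuous_onI)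
  have nonneg: "0 \<le> f x" and bound: "norm (f x) \<le> 1" for x
    by (auto simp: f_def infdist_nonneg)
  have "(\<lambda>n. integral\<^sup>L (conv_partial ms Bs n) f) \<longlonglongrightarrow> integral\<^sup>L \<mu> f"
  proof -
    have "bounded (range f)" using bound by (auto simp: bounded_iff)
    then show ?thesis using lim cont unfolding weak_conv_vec_def by blast
  qed
  moreover have "integral\<^sup>L (conv_partial ms Bs n) f = 0" for n
  proof (rule integral_conv_partial_eq_0[OF fm bound])
    fix x :: "real^'d" assume x: "\<forall>i. 0 \<le> x$i \<and> x$i \<le> 1 - 1 / real (sp 0 n i)"
    have "x \<in> unit_cube"
      unfolding unit_cube_def
    proof (intro CollectI allI)
      fix i
      have "0 \<le> 1 / real (sp 0 n i)" by simp
      then show "0 \<le> x$i \<and> x$i \<le> 1" using x[rule_format, of i] by linarith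
    qed
    then show "f x = 0" by (simp add: f_def)
  qed
  ultimately have "integral\<^sup>L \<mu> f = 0" by (simp add: LIMSEQ_const_iff)
  moreover have "integrable \<mu> f"
    using bound by (intro integrable_const_bound[of _ 1]) auto
  ultimately have "AE x in \<mu>. f x = 0"
    using nonneg integral_nonneg_eq_0_iff_AE by blast
  moreover have "x \<in> unit_cube" if "f x = 0" for x
  proof -
    have "infdist x unit_cube = 0" using that by (simp add: f_def min_def split: if_splits)
    moreover have "(0 :: real^'d) \<in> unit_cube" by (simp add: unit_cube_def)
    ultimately show ?thesis
      using in_closed_iff_infdist_zero[OF closed_unit_cube] by blast
  qed
  ultimately have "AE x in \<mu>. x \<in> unit_cube" by (auto elim: eventually_mono)
  then show ?thesis
    by unfold_locales (simp_all add: sets)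
qed

lemma block_mask_LIMSEQ_integral:
  assumes "prob_space \<mu>" and sets: "sets \<mu> = sets borel" and lim: "weak_conv_vec (conv_partial ms Bs) \<mu>"
  shows "(\<lambda>n. bm 0 n \<xi>) \<longlonglongrightarrow> (\<integral>x. expo \<xi> x \<partial>\<mu>)"
proof -
  have int: "integrable M (expo \<xi>)" if "prob_space M" "sets M = sets borel" for M
  proof -
    interpret prob_space M by fact
    have "expo \<xi> \<in> borel_measurable M"
      using borel_measurable_expo measurable_cong_sets[OF that(2) refl] by blast
    then show ?thesis by (intro integrable_const_bound[of _ 1]) auto
  qed
  \<comment> \<open>Weak convergence is defined with real test functions, so the real and imaginary
    parts are treated separately.\<close>
  have *: "(\<lambda>n. T (bm 0 n \<xi>)) \<longlonglongrightarrow> T (\<integral>x. expo \<xi> x \<partial>\<mu>)"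
    if T: "bounded_linear T" "\<And>z. \<bar>T z\<bar> \<le> cmod z" for T :: "complex \<Rightarrow> real"
  proof -
    have "continuous_on UNIV (\<lambda>x. T (expo \<xi> x))"
      by (intro bounded_linear.continuous_on[OF T(1)] continuous_intros)
    moreover have "bounded (range (\<lambda>x. T (expo \<xi> x)))"
    proof -
      have "norm (T (expo \<xi> x)) \<le> 1" for x using T(2)[of "expo \<xi> x"] by simp
      then show ?thesis unfolding bounded_iff by blast
    qed
    ultimately have "(\<lambda>n. \<integral>x. T (expo \<xi> x) \<partial>conv_partial ms Bs n) \<longlonglongrightarrow> (\<integral>x. T (expo \<xi> x) \<partial>\<mu>)"
      using lim unfolding weak_conv_vec_def by blast
    then show ?thesis
      using integral_bounded_linear[OF T(1) int[OF prob_space_conv_partial sets_conv_partial]]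
        integral_bounded_linear[OF T(1) int[OF assms(1,2)]] integral_expo_conv_partial
      by simp
  qed
  show ?thesis
    unfolding tendsto_complex_iff
    using *[OF bounded_linear_Re abs_Re_le_cmod] *[OF bounded_linear_Im abs_Im_le_cmod] by blast
qed

text \<open>Dominated convergence for sums, done by hand. The index sets \<open>X t\<close> grow
  with \<open>t\<close>, but \<open>lower\<close> dominates the terms at stage \<open>t\<close> by a
  fixed multiple of the limiting terms, whose sums are bounded by Bessel's inequality.\<close>

lemma spectrum_of_good_sequence:
  assumes \<mu>: "prob_space \<mu>" "sets \<mu> = sets borel" "weak_conv_vec (conv_partial ms Bs) \<mu>"
    and "0 < \<epsilon>" and ns: "strict_mono (ns :: nat \<Rightarrow> nat)"
    and X: "\<And>t. X t \<subseteq> X (Suc t)" "\<And>t. good \<epsilon> (ns t) (X t)"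
  shows "is_spectrum \<mu> (int_vec ` (\<Union>t. X t))"
proof -
  interpret cube_measure \<mu> by (rule weak_limit_cube_measure[OF \<mu>])
  define C where "C = 2 * pi * real CARD('d)"
  have "0 < C" by (simp add: C_def)
  have lim: "(\<lambda>n. bm 0 n \<xi>) \<longlonglongrightarrow> char_fn \<xi>" for \<xi>
    unfolding char_fn_def by (rule block_mask_LIMSEQ_integral[OF \<mu>])
  have X_mono: "X s \<subseteq> X t" if "s \<le> t" for s t
    using lift_Suc_mono_le[of X, OF X(1) that] .
  have finX: "finite (X t)" and X1: "unit_square_sum (bm 0 (ns t)) (X t)"
    and Xinf: "\<And>x. x \<in> X t \<Longrightarrow> infinite {N. \<epsilon> \<le> cmod (bm (ns t) N (vdiv (int_vec x) (sp 0 (ns t))))}" for t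
    using X(2)[of t] by (auto simp: good_def)
  have X1_sum: "(\<Sum>x\<in>X t. (cmod (bm 0 (ns t) (\<xi> + int_vec x)))\<^sup>2) = 1" for t \<xi>
    using X1[of t] unfolding unit_square_sum_def by blast
  let ?Lam = "int_vec ` (\<Union>t. X t)"
  have common: "\<exists>t. x \<in> X t \<and> y \<in> X t" if xy: "x \<in> (\<Union>t. X t)" "y \<in> (\<Union>t. X t)" for x y
  proof -
    obtain s t where "x \<in> X s" "y \<in> X t" using xy by blast
    then have "x \<in> X (max s t)" "y \<in> X (max s t)"
      using X_mono[of s "max s t"] X_mono[of t "max s t"] by auto
    then show ?thesis by blast
  qed
  have orth: "char_fn (l - l') = 0" if l: "l \<in> ?Lam" "l' \<in> ?Lam" "l \<noteq> l'" for l l'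
  proof -
    obtain x y where xy: "x \<in> (\<Union>t. X t)" "y \<in> (\<Union>t. X t)" "l = int_vec x" "l' = int_vec y"
      using l by blast
    obtain t where t: "x \<in> X t" "y \<in> X t" using common[OF xy(1,2)] by blast
    have "x \<noteq> y" using l(3) xy by blast
    \<comment> \<open>At \<xi> = -y the term of \<open>y\<close> alone exhausts the total 1, so the
      term of \<open>x\<close> is 0. Every longer block contains this factor, and the zero survives
      in the limit.\<close>
    let ?f = "\<lambda>z. (cmod (bm 0 (ns t) (- int_vec y + int_vec z)))\<^sup>2"
    have "(\<Sum>z\<in>{x, y}. ?f z) \<le> (\<Sum>z\<in>X t. ?f z)"
      using t finX by (intro sum_mono2) auto
    also have "\<dots> = 1" by (rule X1_sum)
    finally have "bm 0 (ns t) (l - l') = 0"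
      using \<open>x \<noteq> y\<close> xy by simp
    then have "bm 0 (ns t + N) (l - l') = 0" for N
      by (simp add: block_mask_add)
    moreover have "(\<lambda>N. bm 0 (ns t + N) (l - l')) \<longlonglongrightarrow> char_fn (l - l')"
      using LIMSEQ_ignore_initial_segment[OF lim, of "ns t"] by (simp add: add.commute)
    ultimately show ?thesis by (simp add: LIMSEQ_const_iff)
  qed
  \<comment> \<open>The transform of a longer block factors into the first \<open>ns t\<close>
    layers and a tail. At \<open>x\<close> itself the tail is at least \<epsilon> infinitely often,
    and shifting by the rescaled \<xi> costs at most \<epsilon>/2.\<close>
  have lower: "\<epsilon> / 2 * cmod (bm 0 (ns t) (\<xi> + int_vec x)) \<le> cmod (char_fn (\<xi> + int_vec x))"
    if x: "x \<in> X t" and close: "C * norm (vdiv \<xi> (sp 0 (ns t))) \<le> \<epsilon> / 2" for t x \<xi>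
  proof (rule infinite_lower_bound_imp_LIMSEQ_ge)
    let ?z = "vdiv (int_vec x) (sp 0 (ns t))" and ?w = "vdiv (\<xi> + int_vec x) (sp 0 (ns t))"
    show "(\<lambda>N. cmod (bm 0 (ns t + N) (\<xi> + int_vec x))) \<longlonglongrightarrow> cmod (char_fn (\<xi> + int_vec x))"
      using tendsto_norm[OF LIMSEQ_ignore_initial_segment[OF lim, of "ns t"]] by (simp add: add.commute)
    have "{N. \<epsilon> \<le> cmod (bm (ns t) N ?z)}
        \<subseteq> {N. \<epsilon> / 2 * cmod (bm 0 (ns t) (\<xi> + int_vec x)) \<le> cmod (bm 0 (ns t + N) (\<xi> + int_vec x))}"
    proof
      fix N assume "N \<in> {N. \<epsilon> \<le> cmod (bm (ns t) N ?z)}"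
      then have N: "\<epsilon> \<le> cmod (bm (ns t) N ?z)" by simp
      have "cmod (bm (ns t) N ?z - bm (ns t) N ?w) \<le> C * norm (?z - ?w)"
        unfolding C_def by (rule block_mask_lipschitz)
      also have "norm (?z - ?w) = norm (vdiv \<xi> (sp 0 (ns t)))"
        by (simp add: vdiv_add)
      finally have "\<epsilon> / 2 \<le> cmod (bm (ns t) N ?w)"
        using N close norm_triangle_ineq2[of "bm (ns t) N ?z" "bm (ns t) N ?w"] by linarith
      then have "\<epsilon> / 2 * cmod (bm 0 (ns t) (\<xi> + int_vec x)) \<le> cmod (bm (ns t) N ?w) * cmod (bm 0 (ns t) (\<xi> + int_vec x))"
        by (intro mult_right_mono) auto
      then show "N \<in> {N. \<epsilon> / 2 * cmod (bm 0 (ns t) (\<xi> + int_vec x)) \<le> cmod (bm 0 (ns t + N) (\<xi> + int_vec x))}"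
        by (simp add: block_mask_add norm_mult mult.commute)
    qed
    then show "infinite {N. \<epsilon> / 2 * cmod (bm 0 (ns t) (\<xi> + int_vec x)) \<le> cmod (bm 0 (ns t + N) (\<xi> + int_vec x))}"
      using Xinf[OF x] infinite_super by blast
  qed
  show ?thesis
  proof (rule is_spectrum_if_parseval[OF _ orth])
    have "countable (\<Union>t. X t)" using finX by (intro countable_UN) (auto simp: countable_finite)
    then show "countable ?Lam" by (rule countable_image)
  next
    fix \<xi> :: "real^'d" and e :: real assume "0 < e"
    \<comment> \<open>The blocks give sums at \<xi> + x and the projections need \<xi> - x;
      conjugation symmetry of \<open>char_fn\<close> translates between them.\<close>
    define a where "a x = (cmod (char_fn (- \<xi> + int_vec x)))\<^sup>2" for x
    have a_eq: "(cmod (char_fn (\<xi> - int_vec x)))\<^sup>2 = a x" for x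
      using char_fn_minus[of "\<xi> - int_vec x"] by (simp add: a_def)
    have inj: "inj int_vec" by (simp add: inj_def vec_eq_iff)
    have sum_le: "(\<Sum>x\<in>F. a x) \<le> 1" if F: "finite F" "F \<subseteq> (\<Union>t. X t)" for F
    proof -
      have "(\<Sum>x\<in>F. a x) = (\<Sum>l\<in>int_vec ` F. (cmod (char_fn (\<xi> - l)))\<^sup>2)"
        using inj by (subst sum.reindex) (auto simp: inj_on_def inj_def a_eq)
      also have "\<dots> \<le> 1" using F by (intro bessel orth) auto
      finally show ?thesis .
    qed
    define S where "S = Sup (sum a ` {F. finite F \<and> F \<subseteq> (\<Union>t. X t)})"
    have bdd: "bdd_above (sum a ` {F. finite F \<and> F \<subseteq> (\<Union>t. X t)})"
      using sum_le by (intro bdd_aboveI[of _ 1]) auto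
    \<comment> \<open>Domination multiplies the tail by 1/(\<epsilon>/2)^2, so that a limiting tail
      of at most \<eta> becomes at most e/2 at stage \<open>t\<close>.\<close>
    define \<eta> where "\<eta> = e / 2 * (\<epsilon> / 2)\<^sup>2"
    have "0 < \<eta>" using \<open>0 < e\<close> \<open>0 < \<epsilon>\<close> by (simp add: \<eta>_def)
    have "\<exists>F. finite F \<and> F \<subseteq> (\<Union>t. X t) \<and> S - \<eta> < sum a F"
    proof -
      have "S - \<eta> < Sup (sum a ` {F. finite F \<and> F \<subseteq> (\<Union>t. X t)})" using \<open>0 < \<eta>\<close> by (simp add: S_def)
      then obtain y where "y \<in> sum a ` {F. finite F \<and> F \<subseteq> (\<Union>t. X t)}" "S - \<eta> < y"
        using less_cSup_iff[OF _ bdd] by blast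
      then show ?thesis by blast
    qed
    then obtain F where F: "finite F" "F \<subseteq> (\<Union>t. X t)" "S - \<eta> < sum a F" by blast
    have tail: "sum a G \<le> \<eta>" if G: "finite G" "G \<subseteq> (\<Union>t. X t)" "G \<inter> F = {}" for G
    proof -
      have "sum a F + sum a G = sum a (F \<union> G)"
        using F G by (subst sum.union_disjoint) auto
      also have "\<dots> \<le> S" unfolding S_def using F G bdd by (intro cSup_upper) auto
      finally show ?thesis using F(3) by simp
    qed
    have ev1: "eventually (\<lambda>t. F \<subseteq> X t) sequentially"
    proof -
      have "\<exists>t. F \<subseteq> X t"
        using F(1,2)
      proof (induction F rule: finite_induct)
        case (insert x F)
        then obtain s t where "F \<subseteq> X s" "x \<in> X t" by blast
        then have "insert x F \<subseteq> X (max s t)"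
          using X_mono[of s "max s t"] X_mono[of t "max s t"] by auto
        then show ?case by blast
      qed simp
      then obtain t0 where "F \<subseteq> X t0" by blast
      then show ?thesis using X_mono unfolding eventually_sequentially by blast
    qed
    have ev2: "eventually (\<lambda>t. C * norm (vdiv (- \<xi>) (sp 0 (ns t))) \<le> \<epsilon> / 2) sequentially"
    proof -
      obtain t0 where t0: "C * norm \<xi> / (\<epsilon> / 2) < 2 ^ t0"
        using real_arch_pow[of 2 "C * norm \<xi> / (\<epsilon> / 2)"] by auto
      have "C * norm (vdiv (- \<xi>) (sp 0 (ns t))) \<le> \<epsilon> / 2" if "t0 \<le> t" for t
      proof -
        have "t0 \<le> ns t" using strict_mono_imp_increasing[OF ns, of t] that by linarith
        have "norm (vdiv (- \<xi>) (sp 0 (ns t))) \<le> norm (- \<xi>) / 2 ^ ns t"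
          by (rule norm_vdiv_le) (rule scale_prod_ge)
        also have "\<dots> \<le> norm (- \<xi>) / 2 ^ t0"
          using \<open>t0 \<le> ns t\<close> by (intro divide_left_mono power_increasing) auto
        finally have "C * norm (vdiv (- \<xi>) (sp 0 (ns t))) \<le> C * (norm \<xi> / 2 ^ t0)"
          using \<open>0 < C\<close> by (intro mult_left_mono) auto
        also have "\<dots> \<le> \<epsilon> / 2" using t0 \<open>0 < \<epsilon>\<close> by (simp add: field_simps)
        finally show ?thesis .
      qed
      then show ?thesis unfolding eventually_sequentially by blast
    qed
    have ev3: "eventually (\<lambda>t. 1 - e / 2 \<le> (\<Sum>x\<in>F. (cmod (bm 0 (ns t) (- \<xi> + int_vec x)))\<^sup>2)) sequentially"
      using ev1 ev2
    proof eventually_elim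
      case (elim t)
      let ?b = "\<lambda>x. (cmod (bm 0 (ns t) (- \<xi> + int_vec x)))\<^sup>2"
      have "1 = (\<Sum>x\<in>X t. ?b x)" by (rule X1_sum[symmetric])
      also have "\<dots> = (\<Sum>x\<in>X t - F. ?b x) + (\<Sum>x\<in>F. ?b x)"
        by (rule sum.subset_diff[OF elim(1) finX])
      finally have split: "1 = (\<Sum>x\<in>X t - F. ?b x) + (\<Sum>x\<in>F. ?b x)" .
      have "(\<Sum>x\<in>X t - F. ?b x) \<le> (\<Sum>x\<in>X t - F. a x / (\<epsilon> / 2)\<^sup>2)"
      proof (rule sum_mono)
        fix x assume "x \<in> X t - F"
        then have "\<epsilon> / 2 * cmod (bm 0 (ns t) (- \<xi> + int_vec x)) \<le> cmod (char_fn (- \<xi> + int_vec x))"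
          using lower elim(2) by blast
        then have "(\<epsilon> / 2 * cmod (bm 0 (ns t) (- \<xi> + int_vec x)))\<^sup>2 \<le> a x"
          unfolding a_def using \<open>0 < \<epsilon>\<close> by (intro power_mono) auto
        then have "?b x * (\<epsilon> / 2)\<^sup>2 \<le> a x" by (simp only: power_mult_distrib mult.commute)
        then show "?b x \<le> a x / (\<epsilon> / 2)\<^sup>2"
          using \<open>0 < \<epsilon>\<close> by (subst pos_le_divide_eq) auto
      qed
      also have "\<dots> = sum a (X t - F) / (\<epsilon> / 2)\<^sup>2" by (simp add: sum_divide_distrib)
      also have "\<dots> \<le> \<eta> / (\<epsilon> / 2)\<^sup>2"
        using finX[of t] by (intro divide_right_mono tail) auto
      also have "\<dots> = e / 2" using \<open>0 < \<epsilon>\<close> by (simp add: \<eta>_def)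
      finally show ?case using split by linarith
    qed
    have "(\<lambda>t. \<Sum>x\<in>F. (cmod (bm 0 (ns t) (- \<xi> + int_vec x)))\<^sup>2) \<longlonglongrightarrow> sum a F"
      unfolding a_def
      by (intro tendsto_intros LIMSEQ_subseq_LIMSEQ[OF lim ns, unfolded comp_def])
    then have "1 - e / 2 \<le> sum a F"
      using ev3 by (rule tendsto_lowerbound) simp
    also have "sum a F = (\<Sum>l\<in>int_vec ` F. (cmod (char_fn (\<xi> - l)))\<^sup>2)"
      using inj by (subst sum.reindex) (auto simp: inj_on_def inj_def a_eq)
    finally have "1 - e < (\<Sum>l\<in>int_vec ` F. (cmod (char_fn (\<xi> - l)))\<^sup>2)"
      using \<open>0 < e\<close> by linarith
    then show "\<exists>F. finite F \<and> F \<subseteq> ?Lam \<and> 1 - e < (\<Sum>l\<in>F. (cmod (char_fn (\<xi> - l)))\<^sup>2)"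
      using F(1,2) by (intro exI[of _ "int_vec ` F"]) auto
  qed
qed

end

theorem theorem1p6:
  fixes ms :: "nat \<Rightarrow> 'd::finite \<Rightarrow> nat"
    and Bs :: "nat \<Rightarrow> (int^'d) set"
    and m :: "'d \<Rightarrow> nat" and B :: "(int^'d) set"
    and \<mu> :: "(real^'d) measure"
  assumes inD: "\<And>n. n \<ge> 1 \<Longrightarrow> in_D (ms n) (Bs n)"
    and adm: "\<And>n. n \<ge> 1 \<Longrightarrow> admissible (ms n) (Bs n)"
    and adm_RB: "admissible m B"
    and inf_often: "infinite {n. n \<ge> 1 \<and> ms n = m \<and> Bs n = B}"
    and big: "\<And>i. m i \<ge> CARD('d) + 1"
    and mu_prob: "prob_space \<mu>" and mu_sets: "sets \<mu> = sets borel"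
    and mu_lim: "weak_conv_vec (conv_partial ms Bs) \<mu>"
  shows "spectral \<mu> \<and> (\<exists>Lam. is_spectrum \<mu> Lam \<and> Lam \<subseteq> range int_vec)"
proof -
  interpret digit_sequence ms Bs by unfold_locales (rule inD)
  obtain \<epsilon> ns X where "0 < \<epsilon>" "strict_mono (ns :: nat \<Rightarrow> nat)"
    "\<And>t. X t \<subseteq> X (Suc t)" "\<And>t. good \<epsilon> (ns t) (X t)"
    using good_sequence_exists[OF adm inf_often big] by blast
  then have "is_spectrum \<mu> (int_vec ` (\<Union>t. X t))"
    by (intro spectrum_of_good_sequence mu_prob mu_sets mu_lim)
  then show ?thesis
    unfolding spectral_def using mu_prob mu_sets by blast
qed

end
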